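(* Let $1\le k<n\le m_L\le J$, and consider the $(J\times n,q^{Jk},d)$ circular-shift-based MRD codes $\mathcal{C}_1$ and $\mathcal{C}_2$ with exponents $l_0,\dots,l_{n-1}$. 1) Suppose $J\neq m_L$ and $l_j=c'j+c \bmod L$ for all $0\le j\le n-1$, where $0\le c\le L-1$ and $1\le c'\le L-1$ are fixed constants such that $\sum_{j=0}^{k-1}c'q^{j}$ is coprime to $L$. Then both $\mathcal{C}_1$ and $\mathcal{C}_2$ are different (as sets of matrices) from every $(J\times n,q^{Jk},d)$ Gabidulin code $\mathcal{M}_{\mathcal{B}}(\mathcal{V})$, regardless of the choice of the basis $\mathcal{B}$ of $\mathbb{F}_{q^J}$ over $\mathbb{F}_q$ and of the $(n,k)$ Gabidulin linear code $\mathcal{V}$ over $\mathbb{F}_{q^J}$. 2) Suppose $J=m_L$. Let $\mathcal{V}$ be the Gabidulin linear code over $\mathbb{F}_{q^J}$ determined by the $n$ $\mathbb{F}_q$-linearly independent elements $\beta^{l_0},\beta^{l_1},\dots,\beta^{l_{n-1}}$ of $\mathbb{F}_{q^J}$, and let $\mathcal{B}=\mathbf{u}_1^{\mathrm T}$ (where $\mathbf{u}_1$ is the second column of $\mathbf{U}$), which is a basis of $\mathbb{F}_{q^J}$ over $\mathbb{F}_q$. Then $$\mathcal{C}_1=\mathcal{M}_{\mathcal{B}}(\mathcal{V}),\qquad \mathcal{C}_2=\mathbf{T}\,\mathcal{M}_{\mathcal{B}}(\mathcal{V})=\mathcal{M}_{\mathcal{B}\mathbf{T}^{-1}}(\mathcal{V}),$$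 where $\mathbf{T}$ is the $J\times J$ invertible matrix $\mathbf{T}=L_{\mathbb{F}_q}[\mathbf{u}_{L-j}]_{j\in\mathcal{J}}\,\mathrm{Diag}([\tau(\beta^j)]_{j\in\mathcal{J}})\,[\mathbf{u}_j]_{j\in\mathcal{J}}^{\mathrm T}$.
   Context: Setting. $q$ is a prime, $L$ is a positive integer with $\gcd(q,L)=1$, $m_L$ is the multiplicative order of $q$ modulo $L$, $\mathcal{J}=\{j:1\le j\le L-1,\ \gcd(j,L)=1\}$, $J=|\mathcal{J}|$, and $m_L\le J$ (automatic for $L\ge 2$). $L_{\mathbb{F}_q}=L \bmod q$ is regarded as a nonzero element of $\mathbb{F}_q$. $\beta\in\mathbb{F}_{q^{m_L}}$ is a primitive $L$-th root of unity. $\mathbf{C}_L=\begin{bmatrix}\mathbf{0}&\mathbf{I}_{L-1}\\1&\mathbf{0}\end{bmatrix}$ is the $L\times L$ cyclic permutation matrix over $\mathbb{F}_q$. $\mathbf{V}_L=[\beta^{ij}]_{0\le i,j\le L-1}$ and $\widetilde{\mathbf{V}}_L=[\beta^{-ij}]_{0\le i,j\le L-1}$. For column vectors $\mathbf{x}_j$, $[\mathbf{x}_j]_{j\in\mathcal{J}}$ denotes their juxtaposition in increasing order of $j$ (so $[\mathbf{u}_{L-j}]_{j\in\mathcal{J}}$ lists the columns $\mathbf{u}_{L-j}$ in increasing order of $j$); $j\notin\mathcal J$ means $0\le j\le L-1$, $j\notin\mathcal{J}$. $\mathrm{Diag}([x_j]_{j\in\mathcal{J}})$ is the diagonal matrix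 with entries $x_j$ in increasing order of $j$. $\tau(x)=\prod_{0\le j\le L-1,\,j\notin\mathcal{J}}(x-\beta^j)\in\mathbb{F}_q[x]$. $\mathbf{U}=[\mathbf{u}_j]_{0\le j\le L-1}$ and $\mathbf{U}'=[\mathbf{u}'_j]_{0\le j\le L-1}$ are matrices in $\mathbb{F}_{q^{m_L}}^{J\times L}$ (columns indexed from $0$) satisfying: $\mathrm{rank}([\mathbf{u}_j]_{j\in\mathcal{J}})=J$; $[\mathbf{u}'_j]_{j\in\mathcal{J}}^{\mathrm T}=L_{\mathbb{F}_q}^{-1}[\mathbf{u}_j]_{j\in\mathcal{J}}^{-1}$; and $[\mathbf{u}_j]_{j\notin\mathcal{J}}=\mathbf{0}$ or $[\mathbf{u}'_j]_{j\notin\mathcal{J}}=\mathbf{0}$. Put $\mathbf{G}_L=\mathbf{U}\widetilde{\mathbf{V}}_L$ and $\mathbf{H}_L=\mathbf{V}_L\mathbf{U}'^{\mathrm T}$; it is assumed that both have all entries in $\mathbb{F}_q$. Codes. For $\mathbf{P}\in\mathbb{F}_q^{J\times L}$, $\mathbf{Q}\in\mathbb{F}_q^{L\times J}$ and distinct exponents $0\le l_0,\dots,l_{n-1}\le L-1$, the circular-shift-based rank-metric code is the set of all matrices $[\mathbf{c}_0^{\mathrm T}\ \cdots\ \mathbf{c}_{n-1}^{\mathrm T}]\in\mathbb{F}_q^{J\times n}$ with $\mathbf{c}_i=\sum_{s=0}^{k-1}\mathbf{m}_s\mathbf{P}\mathbf{C}_L^{q^sl_i}\mathbf{Q}$, where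 $(\mathbf{m}_0,\dots,\mathbf{m}_{k-1})$ ranges over $k$-tuples of row vectors in $\mathbb{F}_q^J$. $\mathcal{C}_1$ is this code for $\mathbf{P}=\mathbf{G}_L,\mathbf{Q}=\mathbf{H}_L$, and $\mathcal{C}_2$ is this code for $\mathbf{P}=\mathbf{G}_L,\mathbf{Q}=\tau(\mathbf{C}_L)\mathbf{G}_L^{\mathrm T}$ (same exponents). They are called circular-shift-based MRD codes when the exponents satisfy $\mathrm{rank}(\sum_{i=0}^{n-1}a_i\mathbf{P}\mathbf{C}_L^{l_i}\mathbf{Q})=J$ for all nonzero $[a_0,\dots,a_{n-1}]\in\mathbb{F}_q^n$ (the condition is the same for both choices of $\mathbf{Q}$); they then have minimum rank distance $d=n-k+1$. Gabidulin codes. For $k\le n\le N$ and $\mathbb{F}_q$-linearly independent $\beta_0,\dots,\beta_{n-1}\in\mathbb{F}_{q^N}$, the $(n,k)$ Gabidulin linear code determined by them is $\mathcal{V}=\{\mathbf{u}\mathbf{G}:\mathbf{u}\in\mathbb{F}_{q^N}^k\}$ with $\mathbf{G}=[\beta_j^{q^i}]_{0\le i\le k-1,0\le j\le n-1}$. For a basis $\mathcal{B}$ of $\mathbb{F}_{q^N}$ over $\mathbb{F}_q$, written as a row vector in $\mathbb{F}_{q^N}^N$, and $\mathbf{v}\in\mathbb{F}_{q^N}^n$, $\mathbf{M}_{\mathcal{B}}(\mathbf{v})\in\mathbb{F}_q^{N\times n}$ is the unique matrix with $\mathcal{B}\mathbf{M}_{\mathcal{B}}(\mathbf{v})=\mathbf{v}$.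 The $(N\times n,q^{Nk},d)$ Gabidulin code is $\mathcal{M}_{\mathcal{B}}(\mathcal{V})=\{\mathbf{M}_{\mathcal{B}}(\mathbf{v}):\mathbf{v}\in\mathcal{V}\}$. Here $N=J$. For a matrix $\mathbf{T}$ and a set $\mathcal{M}$ of matrices, $\mathbf{T}\mathcal{M}=\{\mathbf{T}\mathbf{M}:\mathbf{M}\in\mathcal{M}\}$. *)

theory Defs
  imports
    "Jordan_Normal_Form.DL_Rank"
    "Jordan_Normal_Form.Gauss_Jordan_Elimination"
    "HOL-Number_Theory.Number_Theory"
begin

text \<open>
  The field with \<open>q\<close> elements (\<open>q\<close> prime) and its extensions are separate types of class
  \<^class>\<open>finite_field\<close>; an extension comes with a field homomorphism \<open>\<iota>\<close> from the small field.
  Such a homomorphism is unique because \<open>q\<close> is prime. A matrix or polynomial over the extension all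
  of whose entries lie in \<open>range \<iota>\<close> is regarded as an object over the small field by applying
  \<open>inv_into UNIV \<iota>\<close> entrywise.
\<close>

subsection \<open>Linear algebra\<close>

definition mult_vec_mat :: "'a :: semiring_0 vec \<Rightarrow> 'a mat \<Rightarrow> 'a vec" (infixl \<open>\<^sub>v*\<close> 70) where
  "v \<^sub>v* A = vec (dim_col A) (\<lambda>j. v \<bullet> col A j)"

definition sum_mat :: "nat \<Rightarrow> nat \<Rightarrow> ('i \<Rightarrow> 'a :: comm_monoid_add mat) \<Rightarrow> 'i set \<Rightarrow> 'a mat" where
  "sum_mat nr nc A I = mat nr nc (\<lambda>(a, b). \<Sum>i\<in>I. A i $$ (a, b))"

definition poly_mat :: "'a :: comm_semiring_1 poly \<Rightarrow> 'a mat \<Rightarrow> 'a mat" where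
  "poly_mat p A =
    sum_mat (dim_row A) (dim_row A) (\<lambda>i. Polynomial.coeff p i \<cdot>\<^sub>m (A ^\<^sub>m i)) {..degree p}"

definition select_cols :: "'a mat \<Rightarrow> nat list \<Rightarrow> 'a mat" where
  "select_cols A js = mat_of_cols (dim_row A) (map (col A) js)"

text \<open>
  Independence of a family rather than of a set, hence the injectivity. The qualifier
  \<open>Modules\<close> selects the class-based linear algebra, not the HOL-Algebra locale of the same name.
\<close>

definition lin_indep_over :: "('f :: field \<Rightarrow> 'e :: field) \<Rightarrow> nat \<Rightarrow> (nat \<Rightarrow> 'e) \<Rightarrow> bool" where
  "lin_indep_over \<iota> n b \<longleftrightarrow>
    inj_on b {..<n} \<and> \<not> Modules.module.dependent (\<lambda>a x. \<iota> a * x) (b ` {..<n})"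

definition basis_over :: "('f :: field \<Rightarrow> 'e :: field) \<Rightarrow> nat \<Rightarrow> 'e vec \<Rightarrow> bool" where
  "basis_over \<iota> N B \<longleftrightarrow>
    B \<in> carrier_vec N \<and> lin_indep_over \<iota> N (($) B) \<and>
    Modules.module.span (\<lambda>a x. \<iota> a * x) (($) B ` {..<N}) = UNIV"

subsection \<open>Roots of unity and cyclic matrices\<close>

definition primitive_root_of_unity :: "nat \<Rightarrow> 'a :: monoid_mult \<Rightarrow> bool" where
  "primitive_root_of_unity L \<beta> \<longleftrightarrow> L > 0 \<and> \<beta> ^ L = 1 \<and> (\<forall>i. 0 < i \<and> i < L \<longrightarrow> \<beta> ^ i \<noteq> 1)"

definition coprimes :: "nat \<Rightarrow> nat set" where
  "coprimes L = {j. 1 \<le> j \<and> j \<le> L - 1 \<and> coprime j L}"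

definition coprime_list :: "nat \<Rightarrow> nat list" where
  "coprime_list L = sorted_list_of_set (coprimes L)"

definition cyclic_mat :: "nat \<Rightarrow> 'a :: {zero, one} mat" where
  "cyclic_mat L =
    four_block_mat (0\<^sub>m (L - 1) 1) (1\<^sub>m (L - 1)) (1\<^sub>m 1) (0\<^sub>m 1 (L - 1))"

definition V_mat :: "nat \<Rightarrow> 'a :: field \<Rightarrow> 'a mat" where
  "V_mat L \<beta> = mat L L (\<lambda>(i, j). \<beta> ^ (i * j))"

definition V_tilde_mat :: "nat \<Rightarrow> 'a :: field \<Rightarrow> 'a mat" where
  "V_tilde_mat L \<beta> = mat L L (\<lambda>(i, j). inverse (\<beta> ^ (i * j)))"

definition tau :: "nat \<Rightarrow> 'a :: field \<Rightarrow> 'a poly" where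
  "tau L \<beta> = (\<Prod>j\<in>{0..<L} - coprimes L. [:- (\<beta> ^ j), 1:])"

definition T_mat :: "nat \<Rightarrow> 'a :: field \<Rightarrow> 'a mat \<Rightarrow> 'a mat" where
  "T_mat L \<beta> U =
    of_nat L \<cdot>\<^sub>m
      (select_cols U (map (\<lambda>j. L - j) (coprime_list L))
       * mat_diag (card (coprimes L)) (\<lambda>i. poly (tau L \<beta>) (\<beta> ^ (coprime_list L ! i)))
       * transpose_mat (select_cols U (coprime_list L)))"

subsection \<open>Circular-shift-based rank-metric codes\<close>

definition cs_code ::
    "nat \<Rightarrow> nat \<Rightarrow> nat \<Rightarrow> nat \<Rightarrow> nat \<Rightarrow> (nat \<Rightarrow> nat) \<Rightarrow> 'f :: field mat \<Rightarrow> 'f mat \<Rightarrow> 'f mat set" where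
  "cs_code q L J k n l P Q =
    {mat_of_cols J
       (map (\<lambda>i. finsum_vec TYPE('f) J
                  (\<lambda>s. m s \<^sub>v* (P * cyclic_mat L ^\<^sub>m (q ^ s * l i) * Q)) {..<k})
            [0..<n])
     | m. \<forall>s<k. m s \<in> carrier_vec J}"

definition mrd_exponents ::
    "nat \<Rightarrow> nat \<Rightarrow> nat \<Rightarrow> (nat \<Rightarrow> nat) \<Rightarrow> 'f :: field mat \<Rightarrow> 'f mat \<Rightarrow> bool" where
  "mrd_exponents L J n l P Q \<longleftrightarrow>
    (\<forall>a\<in>carrier_vec n. a \<noteq> 0\<^sub>v n \<longrightarrow>
      vec_space.rank J
        (sum_mat J J (\<lambda>i. (a $ i) \<cdot>\<^sub>m (P * cyclic_mat L ^\<^sub>m (l i) * Q)) {..<n}) = J)"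

subsection \<open>Gabidulin codes\<close>

definition gabidulin_linear_code ::
    "nat \<Rightarrow> nat \<Rightarrow> nat \<Rightarrow> (nat \<Rightarrow> 'e :: field) \<Rightarrow> 'e vec set" where
  "gabidulin_linear_code q k n b =
    {u \<^sub>v* mat k n (\<lambda>(i, j). b j ^ (q ^ i)) | u. u \<in> carrier_vec k}"

text \<open>The description is only meaningful when \<open>B\<close> is a basis over the small field.\<close>

definition expansion_mat :: "('f :: field \<Rightarrow> 'e :: field) \<Rightarrow> 'e vec \<Rightarrow> 'e vec \<Rightarrow> 'f mat" where
  "expansion_mat \<iota> B v =
    (THE M. M \<in> carrier_mat (dim_vec B) (dim_vec v) \<and> B \<^sub>v* map_mat \<iota> M = v)"

definition gabidulin_code ::
    "('f :: field \<Rightarrow> 'e :: field) \<Rightarrow> nat \<Rightarrow> nat \<Rightarrow> nat \<Rightarrow> 'e vec \<Rightarrow> (nat \<Rightarrow> 'e) \<Rightarrow> 'f mat set" where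
  "gabidulin_code \<iota> q k n B b = expansion_mat \<iota> B ` gabidulin_linear_code q k n b"

end

(*
  Let u_j be the columns of U. Since G_L (beta^(ij))_i = L u_j, and the columns of H_L are
  combinations of the eigenvectors (beta^(ij))_i of the cyclic matrix, G_L C^t H_L has the left
  and right eigenbases given by the u'_j and u_j (j coprime to L), with eigenvalues beta^(jt).
  Hence u_j^T M = sum_s (m_s u_j) (beta^(j q^s l_i))_i for the codeword M of (m_s)_s, and
  replacing H_L by tau(C_L) G_L^T amounts to multiplication by T from the left.

  If J = m, the u_j are the Frobenius conjugates of u_1, so u_1 is a basis, and the formula
  with j = 1 says that C_1 is the Gabidulin code.

  If J differs from m, compare left idealizers {X. X C is contained in C}. That of a Gabidulin code contains a
  copy of the field with q^J elements. That of C_1 is diagonal with respect to the u_j: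
  the components of the code are spanned by the rows (x^i)_i with x = beta^(j c' q^s), s < k, up
  to scaling. As k < n, the component of j determines the set of these nodes x, whose product
  beta^(j c' sum_s q^s) determines j. So every X in the idealizer satisfies X^(q^m) = X, which
  fails for some element of the field with q^J > q^m elements.
*)
theory Submission
  imports Defs "Jordan_Normal_Form.Char_Poly"
begin

subsection \<open>Bases over a subfield and Gabidulin codes\<close>

text \<open>The eigenvalues of an idealizer element live in two unrelated fields: one with q^m
  elements on the circular-shift side, one with q^J elements on the Gabidulin side. No common
  extension is formed; the two meet in the equation X^(q^m) = X over the prime field, which can be
  mapped into either. It is stated for the transpose because bases are row vectors: B X = x B makes
  B an eigenvector of the transpose of X. Nodes are separated by polynomials: as the exponents l_i
  form an arithmetic progression modulo L, pairing the n columns with the coefficients of p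
  evaluates p at the nodes, and a polynomial vanishing at k < n nodes fits into n columns. For the
  second code, \<open>tau\<close> does what the zero columns of \<open>U\<close> or
  \<open>U'\<close> do for the first: it removes the eigenvalues beta^j with j not coprime to L.
  \<open>T\<close> is defined over the extension and descends because it is the transpose of G
  tau(C_L) G^T. Multiplying a Gabidulin code by it changes only the basis, so the results for C_2
  follow from those for C_1.\<close>

lemma module_field_hom:
  assumes "field_hom \<iota>"
  shows "Modules.module (\<lambda>a x. \<iota> a * x)"
proof -
  interpret field_hom \<iota> by fact
  show ?thesis
    by unfold_locales (auto simp: hom_distribs algebra_simps)
qed

text \<open>The definition speaks of the image set and therefore demands injectivity separately. The
  coefficient criterion yields it by itself: a repetition \<open>b i = b j\<close> is a nontrivial
  relation.\<close>

lemma lin_indep_over_iff: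
  assumes "field_hom \<iota>"
  shows "lin_indep_over \<iota> n b \<longleftrightarrow> (\<forall>a. (\<Sum>i<n. \<iota> (a i) * b i) = 0 \<longrightarrow> (\<forall>i<n. a i = 0))"
    (is "?l \<longleftrightarrow> ?r")
proof -
  interpret field_hom \<iota> by fact
  interpret M: Modules.module "\<lambda>a x. \<iota> a * x" by (rule module_field_hom) fact
  have re: "(\<Sum>v\<in>b ` {..<n}. \<iota> (u v) * v) = (\<Sum>i<n. \<iota> (u (b i)) * b i)"
    if "inj_on b {..<n}" for u
    using that by (simp add: sum.reindex)
  show ?thesis
  proof
    assume ?l
    then have inj: "inj_on b {..<n}" and ind: "M.independent (b ` {..<n})"
      by (auto simp: lin_indep_over_def)
    show ?r
    proof (intro allI impI)
      fix a i assume s: "(\<Sum>i<n. \<iota> (a i) * b i) = 0" and i: "i < n"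
      define u where "u = a \<circ> the_inv_into {..<n} b"
      have u: "u (b i) = a i" if "i < n" for i
        using that inj by (simp add: u_def the_inv_into_f_f)
      have "(\<Sum>v\<in>b ` {..<n}. \<iota> (u v) * v) = 0"
        using s by (simp add: re[OF inj] u)
      then have "u (b i) = 0"
        using ind i M.dependent_finite[of "b ` {..<n}"] by blast
      then show "a i = 0" using u i by simp
    qed
  next
    assume r: ?r
    have inj: "inj_on b {..<n}"
    proof (rule inj_onI, rule ccontr)
      fix i j assume ij: "i \<in> {..<n}" "j \<in> {..<n}" "b i = b j" "i \<noteq> j"
      \<comment> \<open>The relation that expresses \<open>b i = b j\<close>: coefficient 1 at i and
        -1 at j.\<close>
      define a where "a = (\<lambda>x. (if x = i then 1 else 0) - (if x = j then 1 else 0 :: 'a))"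
      have "(\<Sum>x<n. \<iota> (a x) * b x)
          = (\<Sum>x<n. (if x = i then b x else 0) - (if x = j then b x else 0))"
        by (intro sum.cong) (auto simp: a_def hom_distribs)
      also have "\<dots> = 0" using ij by (simp add: sum_subtractf)
      finally have "a i = 0" using r ij by blast
      then show False using ij by (simp add: a_def)
    qed
    moreover have "M.independent (b ` {..<n})"
      using r re[OF inj] by (subst M.dependent_finite) auto
    ultimately show ?l by (simp add: lin_indep_over_def)
  qed
qed

lemma scalar_prod_map_vec:
  "c \<in> carrier_vec N \<Longrightarrow> B \<bullet> map_vec \<iota> c = (\<Sum>i<N. \<iota> (c $ i) * (B $ i :: 'a :: comm_semiring_0))"
  by (auto simp: scalar_prod_def mult.commute lessThan_atLeast0 intro!: sum.cong)

text \<open>Injectivity of the coordinate map is independence, surjectivity is spanning. In this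
  form a change of basis is a composition of bijections, and over finite fields spanning can be
  replaced by counting.\<close>

lemma basis_over_iff:
  assumes "field_hom \<iota>"
  shows "basis_over \<iota> N B \<longleftrightarrow>
    B \<in> carrier_vec N \<and> bij_betw (\<lambda>c. B \<bullet> map_vec \<iota> c) (carrier_vec N) UNIV"
proof -
  interpret field_hom \<iota> by fact
  interpret M: Modules.module "\<lambda>a x. \<iota> a * x" by (rule module_field_hom) fact
  let ?f = "\<lambda>c. B \<bullet> map_vec \<iota> c"
  have f: "?f (vec N a) = (\<Sum>i<N. \<iota> (a i) * B $ i)" for a
    by (subst scalar_prod_map_vec[of _ N]) auto
  have f_diff: "?f (c - d) = ?f c - ?f d" if "c \<in> carrier_vec N" "d \<in> carrier_vec N" for c d
    using that unfolding scalar_prod_map_vec[OF that(1)] scalar_prod_map_vec[OF that(2)]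
      scalar_prod_map_vec[OF minus_carrier_vec[OF that]]
    by (simp add: hom_distribs left_diff_distrib sum_subtractf)
  have "lin_indep_over \<iota> N (($) B) \<longleftrightarrow> inj_on ?f (carrier_vec N)"
  proof
    assume l: "lin_indep_over \<iota> N (($) B)"
    show "inj_on ?f (carrier_vec N)"
    proof (rule inj_onI)
      fix c d assume cd: "c \<in> carrier_vec N" "d \<in> carrier_vec N" "?f c = ?f d"
      then have "(\<Sum>i<N. \<iota> ((c - d) $ i) * B $ i) = 0"
        using f_diff[of c d] scalar_prod_map_vec[of "c - d" N B] by simp
      then have "\<forall>i<N. (c - d) $ i = 0"
        using l unfolding lin_indep_over_iff[OF assms] by blast
      then show "c = d" using cd by (intro eq_vecI) auto
    qed
  next
    assume inj: "inj_on ?f (carrier_vec N)"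
    show "lin_indep_over \<iota> N (($) B)"
      unfolding lin_indep_over_iff[OF assms]
    proof (intro allI impI)
      fix a i assume "(\<Sum>i<N. \<iota> (a i) * B $ i) = 0" "i < N"
      moreover have "?f (0\<^sub>v N) = 0" by (subst scalar_prod_map_vec[of _ N]) auto
      ultimately have "vec N a = 0\<^sub>v N" using f by (intro inj_onD[OF inj]) auto
      then show "a i = 0" using \<open>i < N\<close> by (metis index_vec index_zero_vec(1))
    qed
  qed
  moreover have "M.span (($) B ` {..<N}) = ?f ` carrier_vec N" if "inj_on (($) B) {..<N}"
  proof -
    have "M.span (($) B ` {..<N}) = range (\<lambda>u. \<Sum>i<N. \<iota> (u (B $ i)) * B $ i)"
      using that by (simp add: M.span_finite sum.reindex)
    also have "\<dots> = ?f ` carrier_vec N"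
    proof (intro equalityI subsetI)
      fix x assume "x \<in> range (\<lambda>u. \<Sum>i<N. \<iota> (u (B $ i)) * B $ i)"
      then obtain u where "x = (\<Sum>i<N. \<iota> (u (B $ i)) * B $ i)" by blast
      then have "x = ?f (vec N (\<lambda>i. u (B $ i)))" by (simp add: f)
      then show "x \<in> ?f ` carrier_vec N" by auto
    next
      fix x assume "x \<in> ?f ` carrier_vec N"
      then obtain c where c: "c \<in> carrier_vec N" "x = ?f c" by blast
      define u where "u = ($) c \<circ> the_inv_into {..<N} (($) B)"
      have "u (B $ i) = c $ i" if "i < N" for i
        using that \<open>inj_on _ _\<close> by (simp add: u_def the_inv_into_f_f[of "($) B"])
      then have "x = (\<Sum>i<N. \<iota> (u (B $ i)) * B $ i)"
        using c by (simp add: scalar_prod_map_vec)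
      then show "x \<in> range (\<lambda>u. \<Sum>i<N. \<iota> (u (B $ i)) * B $ i)" by blast
    qed
    finally show ?thesis .
  qed
  ultimately show ?thesis
    unfolding basis_over_def bij_betw_def by (auto simp: lin_indep_over_def)
qed

text \<open>Both sides have the same finite number of elements, so an injection is onto; vectors are
  counted as functions on {..<N}.\<close>

lemma bij_betw_carrier_vec_UNIV:
  fixes f :: "'f :: finite vec \<Rightarrow> 'e :: finite"
  assumes "card (UNIV :: 'e set) = card (UNIV :: 'f set) ^ N" and "inj_on f (carrier_vec N)"
  shows "bij_betw f (carrier_vec N) UNIV"
proof -
  have "bij_betw (\<lambda>c. restrict (($) c) {..<N}) (carrier_vec N :: 'f vec set) (PiE {..<N} (\<lambda>_. UNIV))"
    by (rule bij_betw_byWitness[where f' = "\<lambda>g. vec N g"]) (auto simp: PiE_def extensional_def fun_eq_iff)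
  then have "card (carrier_vec N :: 'f vec set) = card (UNIV :: 'f set) ^ N"
    by (simp add: bij_betw_same_card card_PiE)
  then have "card (f ` carrier_vec N) = card (UNIV :: 'e set)"
    using assms by (simp add: card_image)
  then have "f ` carrier_vec N = UNIV" by (intro card_subset_eq) auto
  then show ?thesis using assms by (simp add: bij_betw_def)
qed

section \<open>Row vectors times matrices and expansion with respect to a basis\<close>

lemma carrier_mult_vec_mat [simp, intro]: "A \<in> carrier_mat nr nc \<Longrightarrow> v \<^sub>v* A \<in> carrier_vec nc"
  by (auto simp: mult_vec_mat_def)

lemma index_mult_vec_map_mat:
  "M \<in> carrier_mat N n \<Longrightarrow> i < n \<Longrightarrow> (B \<^sub>v* map_mat \<iota> M) $ i = B \<bullet> map_vec \<iota> (col M i)"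
  by (auto simp: mult_vec_mat_def)

lemma mult_vec_mat_assoc:
  assumes "A \<in> carrier_mat n p" and "B \<in> carrier_mat p r" and "v \<in> carrier_vec n"
  shows "(v \<^sub>v* A) \<^sub>v* B = v \<^sub>v* (A * B)"
proof (rule eq_vecI)
  fix i assume i: "i < dim_vec (v \<^sub>v* (A * B))"
  have "(\<Sum>k<p. (\<Sum>j<n. v $ j * A $$ (j,k)) * B $$ (k,i))
      = (\<Sum>j<n. v $ j * (\<Sum>k<p. A $$ (j,k) * B $$ (k,i)))"
    unfolding sum_distrib_right sum_distrib_left by (subst sum.swap) (simp add: mult.assoc)
  then show "((v \<^sub>v* A) \<^sub>v* B) $ i = (v \<^sub>v* (A * B)) $ i"
    using assms i
    by (auto simp: mult_vec_mat_def scalar_prod_def lessThan_atLeast0)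
qed (use assms in \<open>auto simp: mult_vec_mat_def\<close>)

text \<open>Columnwise injectivity of the coordinate map. Together with the existence lemma below it
  gives meaning to the definite description in \<open>expansion_mat\<close>.\<close>

lemma basis_over_mat_unique:
  assumes "field_hom \<iota>" and "basis_over \<iota> N B"
    and "M \<in> carrier_mat N n" and "M' \<in> carrier_mat N n"
    and "B \<^sub>v* map_mat \<iota> M = B \<^sub>v* map_mat \<iota> M'"
  shows "M = M'"
proof (rule mat_col_eqI)
  fix i assume i: "i < dim_col M'"
  then have "(B \<^sub>v* map_mat \<iota> M) $ i = (B \<^sub>v* map_mat \<iota> M') $ i"
    using assms by simp
  then have "B \<bullet> map_vec \<iota> (col M i) = B \<bullet> map_vec \<iota> (col M' i)"
    using assms(3,4) i by (simp add: index_mult_vec_map_mat)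
  then show "col M i = col M' i"
    using assms(2-4) i unfolding basis_over_iff[OF assms(1)] bij_betw_def
    by (auto dest!: inj_onD)
qed (use assms in auto)

lemma basis_over_mat_exists:
  assumes "field_hom \<iota>" and "basis_over \<iota> N B" and "v \<in> carrier_vec n"
  obtains M where "M \<in> carrier_mat N n" and "B \<^sub>v* map_mat \<iota> M = v"
proof -
  have "\<exists>c\<in>carrier_vec N. B \<bullet> map_vec \<iota> c = x" for x
  proof -
    have "x \<in> (\<lambda>c. B \<bullet> map_vec \<iota> c) ` carrier_vec N"
      using assms(2) unfolding basis_over_iff[OF assms(1)] bij_betw_def by simp
    then show ?thesis by blast
  qed
  then obtain c where c: "\<And>x. c x \<in> carrier_vec N" "\<And>x. B \<bullet> map_vec \<iota> (c x) = x" by metis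
  define M where "M = mat N n (\<lambda>(i, j). c (v $ j) $ i)"
  have M: "M \<in> carrier_mat N n" by (simp add: M_def)
  have "col M i = c (v $ i)" if "i < n" for i
    using that c(1)[of "v $ i"] by (intro eq_vecI) (auto simp: M_def)
  then have "B \<^sub>v* map_mat \<iota> M = v"
    using M assms(3) c(2) by (intro eq_vecI) (auto simp: mult_vec_mat_def)
  with M show ?thesis by (rule that)
qed

text \<open>Membership becomes a condition on the matrix itself, and the definite description
  disappears from the later arguments.\<close>

lemma gabidulin_code_eq:
  assumes "field_hom \<iota>" and "basis_over \<iota> N B"
  shows "gabidulin_code \<iota> q k n B b =
    {M \<in> carrier_mat N n. B \<^sub>v* map_mat \<iota> M \<in> gabidulin_linear_code q k n b}"
proof -
  have B: "dim_vec B = N" using assms(2) by (auto simp: basis_over_def)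
  have exp: "expansion_mat \<iota> B (B \<^sub>v* map_mat \<iota> M) = M" if "M \<in> carrier_mat N n" for M
    unfolding expansion_mat_def
    by (rule the_equality)
      (use that basis_over_mat_unique[OF assms _ that] in \<open>auto simp: B mult_vec_mat_def\<close>)
  have lin: "v \<in> carrier_vec n" if "v \<in> gabidulin_linear_code q k n b" for v
    using that by (auto simp: gabidulin_linear_code_def mult_vec_mat_def)
  show ?thesis unfolding gabidulin_code_def
  proof (intro equalityI subsetI)
    fix M assume "M \<in> expansion_mat \<iota> B ` gabidulin_linear_code q k n b"
    then obtain v where v: "v \<in> gabidulin_linear_code q k n b" "M = expansion_mat \<iota> B v" by blast
    obtain M' where "M' \<in> carrier_mat N n" "B \<^sub>v* map_mat \<iota> M' = v"
      using basis_over_mat_exists[OF assms lin[OF v(1)]] .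
    then show "M \<in> {M \<in> carrier_mat N n. B \<^sub>v* map_mat \<iota> M \<in> gabidulin_linear_code q k n b}"
      using v exp[of M'] by auto
  next
    fix M assume "M \<in> {M \<in> carrier_mat N n. B \<^sub>v* map_mat \<iota> M \<in> gabidulin_linear_code q k n b}"
    then show "M \<in> expansion_mat \<iota> B ` gabidulin_linear_code q k n b"
      using exp[of M] by (auto intro!: rev_image_eqI)
  qed
qed

lemma map_mat_mult_hom:
  assumes "field_hom \<iota>" and "A \<in> carrier_mat n p" and "B \<in> carrier_mat p r"
  shows "map_mat \<iota> (A * B) = map_mat \<iota> A * map_mat \<iota> B"
proof -
  interpret field_hom \<iota> by fact
  show ?thesis using assms(2,3) by (rule mat_hom_mult)
qed

text \<open>The coordinate map of the new basis is the old one composed with the bijection that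
  sends c to R' c.\<close>

lemma basis_over_mult_inverse:
  assumes hom: "field_hom \<iota>" and B: "basis_over \<iota> N B"
    and R: "R \<in> carrier_mat N N" "R' \<in> carrier_mat N N" "R * R' = 1\<^sub>m N" "R' * R = 1\<^sub>m N"
  shows "basis_over \<iota> N (B \<^sub>v* map_mat \<iota> R')" (is "basis_over _ _ ?B")
proof -
  interpret field_hom \<iota> by fact
  have Bc: "B \<in> carrier_vec N" using B by (simp add: basis_over_def)
  have bij: "bij_betw ((*\<^sub>v) R') (carrier_vec N) (carrier_vec N)"
    by (rule bij_betw_byWitness[where f' = "(*\<^sub>v) R"])
      (use R in \<open>auto simp flip: assoc_mult_mat_vec\<close>)
  have "?B \<bullet> map_vec \<iota> c = B \<bullet> map_vec \<iota> (R' *\<^sub>v c)" if c: "c \<in> carrier_vec N" for c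
  proof -
    \<comment> \<open>A coordinate vector is treated as a matrix with one column, so that
      associativity of the row-vector product applies.\<close>
    define M where "M = mat_of_cols N [c]"
    have M: "M \<in> carrier_mat N 1" and col: "col M 0 = c" using c by (auto simp: M_def)
    have "?B \<bullet> map_vec \<iota> c = (?B \<^sub>v* map_mat \<iota> M) $ 0"
      using M col by (simp add: index_mult_vec_map_mat)
    also have "\<dots> = (B \<^sub>v* map_mat \<iota> (R' * M)) $ 0"
      using R Bc M by (simp add: mult_vec_mat_assoc[of _ N N _ 1] mat_hom_mult)
    also have "\<dots> = B \<bullet> map_vec \<iota> (R' *\<^sub>v c)"
    proof -
      have "col (R' * M) 0 = R' *\<^sub>v c"
        unfolding col[symmetric] by (rule col_mult2[OF R(2) M]) simp
      moreover have "R' * M \<in> carrier_mat N 1" using R(2) M by (rule mult_carrier_mat)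
      from index_mult_vec_map_mat[OF this, of 0 B \<iota>]
      have "(B \<^sub>v* map_mat \<iota> (R' * M)) $ 0 = B \<bullet> map_vec \<iota> (col (R' * M) 0)" by simp
      ultimately show ?thesis by (simp only:)
    qed
    finally show ?thesis .
  qed
  then have "bij_betw (\<lambda>c. ?B \<bullet> map_vec \<iota> c) (carrier_vec N) UNIV
      = bij_betw ((\<lambda>c. B \<bullet> map_vec \<iota> c) \<circ> (*\<^sub>v) R') (carrier_vec N) UNIV"
    by (intro bij_betw_cong) auto
  also have "\<dots>"
    using bij B unfolding basis_over_iff[OF hom] by (auto intro: bij_betw_trans)
  finally show ?thesis
    unfolding basis_over_iff[OF hom] using R by auto
qed

text \<open>Since (B R') X = B (R' X), the new basis expands X exactly as B expands R' X.\<close>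

lemma image_gabidulin_code:
  assumes hom: "field_hom \<iota>" and B: "basis_over \<iota> N B"
    and R: "R \<in> carrier_mat N N" "R' \<in> carrier_mat N N" "R * R' = 1\<^sub>m N" "R' * R = 1\<^sub>m N"
  shows "(*) R ` gabidulin_code \<iota> q k n B b = gabidulin_code \<iota> q k n (B \<^sub>v* map_mat \<iota> R') b"
proof -
  interpret field_hom \<iota> by fact
  have Bc: "B \<in> carrier_vec N" using B by (simp add: basis_over_def)
  have ass: "(B \<^sub>v* map_mat \<iota> R') \<^sub>v* map_mat \<iota> M = B \<^sub>v* map_mat \<iota> (R' * M)"
    if "M \<in> carrier_mat N n" for M
    using that R Bc by (simp add: mult_vec_mat_assoc[of _ N N _ n] mat_hom_mult)
  have c1: "R' * (R * M) = M" "R * (R' * M) = M" if "M \<in> carrier_mat N n" for M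
    using that R by (simp_all flip: assoc_mult_mat[of _ N N _ N _ n])
  show ?thesis
    unfolding gabidulin_code_eq[OF hom B] gabidulin_code_eq[OF hom basis_over_mult_inverse[OF assms]]
  proof (intro equalityI subsetI)
    fix X assume "X \<in> {M \<in> carrier_mat N n.
      (B \<^sub>v* map_mat \<iota> R') \<^sub>v* map_mat \<iota> M \<in> gabidulin_linear_code q k n b}"
    then have "X \<in> carrier_mat N n"
      and "B \<^sub>v* map_mat \<iota> (R' * X) \<in> gabidulin_linear_code q k n b"
      using ass[of X] by simp_all
    then show "X \<in> (*) R ` {M \<in> carrier_mat N n. B \<^sub>v* map_mat \<iota> M \<in> gabidulin_linear_code q k n b}"
      using c1(2)[of X] R by (intro image_eqI[of _ _ "R' * X"]) simp_all
  next
    fix X assume "X \<in> (*) R ` {M \<in> carrier_mat N n. B \<^sub>v* map_mat \<iota> M \<in> gabidulin_linear_code q k n b}"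
    then obtain M where M: "M \<in> carrier_mat N n" "X = R * M"
      "B \<^sub>v* map_mat \<iota> M \<in> gabidulin_linear_code q k n b" by blast
    then show "X \<in> {M \<in> carrier_mat N n.
      (B \<^sub>v* map_mat \<iota> R') \<^sub>v* map_mat \<iota> M \<in> gabidulin_linear_code q k n b}"
      using R by (simp add: ass c1)
  qed
qed

lemma gabidulin_linear_code_eq:
  "gabidulin_linear_code q k n b = {vec n (\<lambda>i. \<Sum>s<k. u $ s * b i ^ (q ^ s)) | u. u \<in> carrier_vec k}"
proof -
  have "u \<^sub>v* mat k n (\<lambda>(i, j). b j ^ (q ^ i)) = vec n (\<lambda>i. \<Sum>s<k. u $ s * b i ^ (q ^ s))" for u
    by (rule eq_vecI) (auto simp: mult_vec_mat_def scalar_prod_def lessThan_atLeast0)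
  then show ?thesis by (simp add: gabidulin_linear_code_def)
qed

lemma gabidulin_linear_code_smult:
  fixes b :: "nat \<Rightarrow> 'e :: field"
  assumes "v \<in> gabidulin_linear_code q k n b"
  shows "x \<cdot>\<^sub>v v \<in> gabidulin_linear_code q k n b"
proof -
  obtain u where u: "u \<in> carrier_vec k" "v = vec n (\<lambda>i. \<Sum>s<k. u $ s * b i ^ (q ^ s))"
    using assms unfolding gabidulin_linear_code_eq by blast
  then have "x \<cdot>\<^sub>v v = vec n (\<lambda>i. \<Sum>s<k. (x \<cdot>\<^sub>v u) $ s * b i ^ (q ^ s))"
    by (intro eq_vecI) (auto simp: sum_distrib_left mult.assoc)
  moreover have "x \<cdot>\<^sub>v u \<in> carrier_vec k" using u by simp
  ultimately show ?thesis unfolding gabidulin_linear_code_eq by blast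
qed

text \<open>The element 1 is a combination of the entries. This ensures that B, used later as an
  eigenvector, is not zero.\<close>

lemma basis_over_nonzero:
  assumes "field_hom \<iota>" and "basis_over \<iota> N B"
  obtains i where "i < N" and "B $ i \<noteq> 0"
proof -
  have "1 \<in> (\<lambda>c. B \<bullet> map_vec \<iota> c) ` carrier_vec N"
    using assms(2) unfolding basis_over_iff[OF assms(1)] bij_betw_def by simp
  then obtain c where c: "c \<in> carrier_vec N" "B \<bullet> map_vec \<iota> c = 1" by force
  have "\<exists>i<N. B $ i \<noteq> 0"
  proof (rule ccontr)
    assume "\<not> ?thesis"
    then have "B \<bullet> map_vec \<iota> c = 0" using c(1) by (simp add: scalar_prod_map_vec)
    then show False using c(2) by simp
  qed
  then show ?thesis using that by blast
qed

text \<open>X is multiplication by x written in the basis B, and the linear code is closed under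
  scaling by x. These matrices are the copy of the large field inside the left idealizer.\<close>

lemma gabidulin_code_scalar_mat:
  fixes \<iota> :: "'f :: field \<Rightarrow> 'e :: field"
  assumes hom: "field_hom \<iota>" and B: "basis_over \<iota> N B"
  obtains X where "X \<in> carrier_mat N N" and "B \<^sub>v* map_mat \<iota> X = x \<cdot>\<^sub>v B"
    and "\<And>M. M \<in> gabidulin_code \<iota> q k n B b \<Longrightarrow> X * M \<in> gabidulin_code \<iota> q k n B b"
proof -
  have Bc: "B \<in> carrier_vec N" using B by (simp add: basis_over_def)
  then have "x \<cdot>\<^sub>v B \<in> carrier_vec N" by simp
  then obtain X where X: "X \<in> carrier_mat N N" "B \<^sub>v* map_mat \<iota> X = x \<cdot>\<^sub>v B"
    by (rule basis_over_mat_exists[OF hom B])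
  have "X * M \<in> gabidulin_code \<iota> q k n B b" if "M \<in> gabidulin_code \<iota> q k n B b" for M
  proof -
    have M: "M \<in> carrier_mat N n" "B \<^sub>v* map_mat \<iota> M \<in> gabidulin_linear_code q k n b"
      using that unfolding gabidulin_code_eq[OF hom B] by auto
    have "B \<^sub>v* map_mat \<iota> (X * M) = (B \<^sub>v* map_mat \<iota> X) \<^sub>v* map_mat \<iota> M"
      unfolding map_mat_mult_hom[OF hom X(1) M(1)]
      by (rule mult_vec_mat_assoc[symmetric]) (use X M Bc in auto)
    also have "\<dots> = x \<cdot>\<^sub>v (B \<^sub>v* map_mat \<iota> M)"
      unfolding X(2) using Bc M(1) by (intro eq_vecI) (auto simp: mult_vec_mat_def)
    finally show ?thesis
      unfolding gabidulin_code_eq[OF hom B]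
      using gabidulin_linear_code_smult[OF M(2), of x] X(1) M(1) by auto
  qed
  with X show ?thesis by (rule that)
qed

subsection \<open>Matrices, roots of unity and the cyclic matrix\<close>

lemma det_nonzero_obtain_inverse:
  fixes A :: "'a :: field mat"
  assumes "A \<in> carrier_mat n n" and "det A \<noteq> 0"
  obtains B where "B \<in> carrier_mat n n" and "A * B = 1\<^sub>m n" and "B * A = 1\<^sub>m n"
  using det_non_zero_imp_unit[OF assms, where b = "()"] that
  by (auto simp: Units_def ring_mat_simps)

lemma mat_inverse_eqI:
  fixes A :: "'a :: field mat"
  assumes A: "A \<in> carrier_mat n n" and B: "B \<in> carrier_mat n n" and AB: "A * B = 1\<^sub>m n"
  shows "mat_inverse A = Some B"
proof -
  have BA: "B * A = 1\<^sub>m n" by (rule mat_mult_left_right_inverse[OF A B AB])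
  then have "A \<in> Units (ring_mat TYPE('a) n ())"
    using A B AB by (auto simp: Units_def ring_mat_simps)
  then obtain B' where inv: "mat_inverse A = Some B'"
    using mat_inverse(1)[OF A, where b = "()"] by (cases "mat_inverse A") auto
  then have B': "A * B' = 1\<^sub>m n" "B' \<in> carrier_mat n n"
    using mat_inverse(2)[OF A] by auto
  have "B' = (B * A) * B'" using BA B' by simp
  also have "\<dots> = B * (A * B')" by (rule assoc_mult_mat[OF B A B'(2)])
  finally have "B' = B" using B B' by simp
  then show ?thesis using inv by simp
qed

lemma pow_mat_eigenvector:
  fixes A :: "'a :: field mat"
  assumes "A \<in> carrier_mat n n" and "v \<in> carrier_vec n" and "A *\<^sub>v v = z \<cdot>\<^sub>v v"
  shows "A ^\<^sub>m t *\<^sub>v v = z ^ t \<cdot>\<^sub>v v"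
proof (induction t)
  case 0
  show ?case using assms by simp
next
  case (Suc t)
  have "A ^\<^sub>m Suc t *\<^sub>v v = A ^\<^sub>m t *\<^sub>v (z \<cdot>\<^sub>v v)"
    using assms by (simp add: assoc_mult_mat_vec[of _ n n _ n])
  also have "\<dots> = z \<cdot>\<^sub>v (A ^\<^sub>m t *\<^sub>v v)"
    using pow_carrier_mat[OF assms(1)] assms(2) by (rule mult_mat_vec)
  finally show ?case using Suc.IH by (simp add: smult_smult_assoc)
qed

lemma index_mult_mat_vec_sum:
  "A \<in> carrier_mat nr n \<Longrightarrow> v \<in> carrier_vec n \<Longrightarrow> a < nr \<Longrightarrow>
    (A *\<^sub>v v) $ a = (\<Sum>b<n. A $$ (a, b) * v $ b)"
  by (auto simp: scalar_prod_def lessThan_atLeast0 intro!: sum.cong)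

lemma poly_mat_carrier [simp]: "A \<in> carrier_mat n n \<Longrightarrow> poly_mat p A \<in> carrier_mat n n"
  by (auto simp: poly_mat_def sum_mat_def)

lemma poly_mat_eigenvector:
  fixes A :: "'a :: field mat"
  assumes A: "A \<in> carrier_mat n n" and v: "v \<in> carrier_vec n" and e: "A *\<^sub>v v = z \<cdot>\<^sub>v v"
  shows "poly_mat p A *\<^sub>v v = poly p z \<cdot>\<^sub>v v"
proof (rule eq_vecI)
  fix a assume "a < dim_vec (poly p z \<cdot>\<^sub>v v)"
  then have a: "a < n" using v by simp
  have pow: "A ^\<^sub>m i \<in> carrier_mat n n" for i using A by simp
  have "poly_mat p A $$ (a, b) = (\<Sum>i\<le>degree p. Polynomial.coeff p i * (A ^\<^sub>m i) $$ (a, b))"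
    if "b < n" for b
    using a that A carrier_matD[OF pow]
    by (simp add: poly_mat_def sum_mat_def)
  then have "(poly_mat p A *\<^sub>v v) $ a
      = (\<Sum>b<n. (\<Sum>i\<le>degree p. Polynomial.coeff p i * (A ^\<^sub>m i) $$ (a, b)) * v $ b)"
    by (simp add: index_mult_mat_vec_sum[OF poly_mat_carrier[OF A] v a])
  also have "\<dots> = (\<Sum>i\<le>degree p. Polynomial.coeff p i * (\<Sum>b<n. (A ^\<^sub>m i) $$ (a, b) * v $ b))"
    unfolding sum_distrib_right sum_distrib_left by (subst sum.swap) (simp add: mult.assoc)
  also have "\<dots> = (\<Sum>i\<le>degree p. Polynomial.coeff p i * (A ^\<^sub>m i *\<^sub>v v) $ a)"
    by (simp only: index_mult_mat_vec_sum[OF pow v a])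
  also have "\<dots> = (\<Sum>i\<le>degree p. Polynomial.coeff p i * z ^ i) * v $ a"
    using v a by (simp add: pow_mat_eigenvector[OF A v e] sum_distrib_right mult.assoc)
  finally show "(poly_mat p A *\<^sub>v v) $ a = (poly p z \<cdot>\<^sub>v v) $ a"
    using v a by (simp add: poly_altdef)
qed (use A v in \<open>simp add: poly_mat_def sum_mat_def\<close>)

text \<open>A field homomorphism is injective, so it preserves the degree that bounds the sum in
  \<open>poly_mat\<close>.\<close>

lemma map_poly_mat:
  assumes "field_hom \<iota>" and "A \<in> carrier_mat n n"
  shows "map_mat \<iota> (poly_mat p A) = poly_mat (map_poly \<iota> p) (map_mat \<iota> A)"
proof -
  interpret field_hom \<iota> by fact
  have pow: "A ^\<^sub>m i \<in> carrier_mat n n" for i using assms by simp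
  have d: "dim_row (A ^\<^sub>m i) = n" "dim_col (A ^\<^sub>m i) = n" for i using carrier_matD[OF pow] by auto
  have dA: "dim_row A = n" using assms by simp
  have mp: "map_mat \<iota> A ^\<^sub>m i = map_mat \<iota> (A ^\<^sub>m i)" for i
    using mat_hom_pow[OF assms(2)] by simp
  show ?thesis
  proof (rule eq_matI)
    fix a b assume "a < dim_row (poly_mat (map_poly \<iota> p) (map_mat \<iota> A))"
      "b < dim_col (poly_mat (map_poly \<iota> p) (map_mat \<iota> A))"
    then have ab: "a < n" "b < n" using dA by (auto simp: poly_mat_def sum_mat_def)
    have "map_mat \<iota> (poly_mat p A) $$ (a, b)
        = (\<Sum>i\<le>degree p. \<iota> (Polynomial.coeff p i * (A ^\<^sub>m i) $$ (a, b)))"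
      using ab d dA by (simp add: poly_mat_def sum_mat_def hom_sum)
    also have "\<dots> = poly_mat (map_poly \<iota> p) (map_mat \<iota> A) $$ (a, b)"
      unfolding poly_mat_def sum_mat_def mp using ab d dA by (simp add: hom_mult coeff_map_poly degree_map_poly)
    finally show "map_mat \<iota> (poly_mat p A) $$ (a, b) = poly_mat (map_poly \<iota> p) (map_mat \<iota> A) $$ (a, b)" .
  qed (use dA in \<open>simp_all add: poly_mat_def sum_mat_def\<close>)
qed

text \<open>For z^L = 1 this is an eigenvector of the cyclic matrix with eigenvalue z. Column j of
  \<open>V_mat\<close> is the case z = beta^j, column j of \<open>V_tilde_mat\<close> the case of
  the inverse power.\<close>

definition root_vec :: "nat \<Rightarrow> 'a :: monoid_mult \<Rightarrow> 'a vec" where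
  "root_vec L z = vec L (\<lambda>i. z ^ i)"

lemma root_vec_carrier [simp]: "root_vec L z \<in> carrier_vec L"
  and dim_root_vec [simp]: "dim_vec (root_vec L z) = L"
  and index_root_vec [simp]: "i < L \<Longrightarrow> root_vec L z $ i = z ^ i"
  by (simp_all add: root_vec_def)

lemma cyclic_mat_carrier [simp]: "L > 0 \<Longrightarrow> cyclic_mat L \<in> carrier_mat L L"
  unfolding cyclic_mat_def
  using four_block_carrier_mat[OF zero_carrier_mat[of "L - 1" 1] zero_carrier_mat[of 1 "L - 1"]] by simp

lemma index_cyclic_mat:
  assumes "i < L" and "j < L"
  shows "cyclic_mat L $$ (i, j) = (if j = Suc i mod L then 1 else 0)"
  using assms by (auto simp: cyclic_mat_def mod_Suc)

lemma map_cyclic_mat: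
  assumes "field_hom \<iota>" and "L > 0"
  shows "map_mat \<iota> (cyclic_mat L) = cyclic_mat L"
proof -
  interpret field_hom \<iota> by fact
  have "cyclic_mat L \<in> carrier_mat L L" "(cyclic_mat L :: 'b mat) \<in> carrier_mat L L"
    using assms by auto
  then show ?thesis
    by (intro eq_matI) (auto simp: index_cyclic_mat carrier_matD[of _ L L])
qed

lemma power_mod_eq:
  fixes z :: "'a :: monoid_mult"
  assumes "z ^ L = 1"
  shows "z ^ (i mod L) = z ^ i"
proof -
  have "z ^ i = z ^ (L * (i div L) + i mod L)" by simp
  also have "\<dots> = z ^ (i mod L)" by (simp only: power_add power_mult assms) simp
  finally show ?thesis ..
qed

lemma cyclic_mat_root_vec:
  fixes z :: "'a :: comm_semiring_1"
  assumes "L > 0" and "z ^ L = 1"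
  shows "cyclic_mat L *\<^sub>v root_vec L z = z \<cdot>\<^sub>v root_vec L z"
proof (rule eq_vecI)
  fix i assume "i < dim_vec (z \<cdot>\<^sub>v root_vec L z)"
  then have i: "i < L" by simp
  have "(cyclic_mat L *\<^sub>v root_vec L z) $ i = (\<Sum>j<L. cyclic_mat L $$ (i, j) * z ^ j)"
    using i carrier_matD[OF cyclic_mat_carrier[OF assms(1), where ?'a = 'a]]
    by (auto simp: scalar_prod_def lessThan_atLeast0 intro!: sum.cong)
  also have "\<dots> = (\<Sum>j<L. if j = Suc i mod L then z ^ j else 0)"
    using i by (intro sum.cong) (auto simp: index_cyclic_mat)
  also have "\<dots> = z ^ (Suc i mod L)" using assms(1) by simp
  finally show "(cyclic_mat L *\<^sub>v root_vec L z) $ i = (z \<cdot>\<^sub>v root_vec L z) $ i"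
    using i power_mod_eq[OF assms(2), of "Suc i"] by simp
qed (use carrier_matD[OF cyclic_mat_carrier[OF assms(1), where ?'a = 'a]] in simp)

lemma primitive_root_power_eq_1_iff:
  assumes "primitive_root_of_unity L \<beta>"
  shows "\<beta> ^ i = 1 \<longleftrightarrow> L dvd i"
proof -
  have L: "L > 0" "\<beta> ^ L = 1" "\<And>i. 0 < i \<Longrightarrow> i < L \<Longrightarrow> \<beta> ^ i \<noteq> 1"
    using assms by (auto simp: primitive_root_of_unity_def)
  have "\<beta> ^ i = 1 \<longleftrightarrow> \<beta> ^ (i mod L) = 1" by (simp add: power_mod_eq L)
  also have "\<dots> \<longleftrightarrow> i mod L = 0" using L(1) L(3)[of "i mod L"] by (metis gr0I mod_less_divisor power_0)
  finally show ?thesis by (simp add: dvd_eq_mod_eq_0)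
qed

lemma primitive_root_nonzero:
  "primitive_root_of_unity L (\<beta> :: 'a :: field) \<Longrightarrow> \<beta> \<noteq> 0"
  by (auto simp: primitive_root_of_unity_def power_0_left split: if_splits)

lemma primitive_root_power_eq_iff:
  fixes \<beta> :: "'a :: field"
  assumes "primitive_root_of_unity L \<beta>"
  shows "\<beta> ^ i = \<beta> ^ j \<longleftrightarrow> [i = j] (mod L)"
proof -
  have *: "\<beta> ^ i = \<beta> ^ j \<longleftrightarrow> [i = j] (mod L)" if "i \<le> j" for i j
  proof -
    have "\<beta> ^ j = \<beta> ^ i * \<beta> ^ (j - i)" using that by (simp flip: power_add)
    then have "\<beta> ^ i = \<beta> ^ j \<longleftrightarrow> \<beta> ^ (j - i) = 1"
      using primitive_root_nonzero[OF assms] by auto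
    also have "\<dots> \<longleftrightarrow> [i = j] (mod L)"
      using that by (simp add: primitive_root_power_eq_1_iff[OF assms] cong_altdef_nat cong_sym_eq[of i])
    finally show ?thesis .
  qed
  show ?thesis using *[of i j] *[of j i] by (cases "i \<le> j") (auto simp: cong_sym_eq[of i])
qed

lemma sum_powers_root_of_unity:
  fixes r :: "'a :: field"
  assumes "r ^ L = 1"
  shows "(\<Sum>d<L. r ^ d) = (if r = 1 then of_nat L else 0)"
  using assms by (auto simp: geometric_sum)

section \<open>Exponents coprime to L\<close>

lemma finite_coprimes [simp]: "finite (coprimes L)"
  by (rule finite_subset[of _ "{..L}"]) (auto simp: coprimes_def)

lemma coprimes_less: "j \<in> coprimes L \<Longrightarrow> j < L"
  by (auto simp: coprimes_def)

lemma coprimes_diff: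
  assumes "j \<in> coprimes L"
  shows "L - j \<in> coprimes L"
proof -
  have "coprime (L - j) L \<longleftrightarrow> coprime j L"
    using coprimes_less[OF assms] by (metis coprime_commute coprime_diff_one_left_nat gcd_diff1_nat gcd_diff2_nat coprime_iff_gcd_eq_1 less_imp_le)
  then show ?thesis using assms by (auto simp: coprimes_def)
qed

lemma bij_betw_coprimes_diff: "bij_betw (\<lambda>j. L - j) (coprimes L) (coprimes L)"
  by (rule bij_betw_byWitness[where f' = "\<lambda>j. L - j"])
    (use coprimes_diff coprimes_less in \<open>fastforce+\<close>)

lemma set_coprime_list [simp]: "set (coprime_list L) = coprimes L"
  and length_coprime_list [simp]: "length (coprime_list L) = card (coprimes L)"
  and distinct_coprime_list [simp]: "distinct (coprime_list L)"
  by (simp_all add: coprime_list_def)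

lemma coprime_list_nth [simp]: "i < card (coprimes L) \<Longrightarrow> coprime_list L ! i \<in> coprimes L"
  by (metis length_coprime_list nth_mem set_coprime_list)

lemma bij_betw_coprime_list: "bij_betw ((!) (coprime_list L)) {..<card (coprimes L)} (coprimes L)"
  by (rule bij_betw_nth) auto

lemma sum_coprime_list: "(\<Sum>i<card (coprimes L). f (coprime_list L ! i)) = (\<Sum>j\<in>coprimes L. f j)"
  by (rule sum.reindex_bij_betw) (rule bij_betw_coprime_list)

lemma select_cols_carrier [simp]: "A \<in> carrier_mat nr nc \<Longrightarrow> select_cols A js \<in> carrier_mat nr (length js)"
  by (rule carrier_matI) (simp_all add: select_cols_def)

lemma index_select_cols:
  assumes "A \<in> carrier_mat nr nc" and "a < nr" and "i < length js" and "js ! i < nc"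
  shows "select_cols A js $$ (a, i) = A $$ (a, js ! i)"
  using assms by (auto simp: select_cols_def mat_of_cols_index)

lemma setcompr_cong: "(\<And>m. P m \<Longrightarrow> f m = g m) \<Longrightarrow> {f m | m. P m} = {g m | m. P m}"
  by (intro Collect_cong ex_cong1) auto

lemma cs_code_eq:
  fixes P Q :: "'f :: field mat"
  assumes "P \<in> carrier_mat J L" and "Q \<in> carrier_mat L J" and "L > 0"
  shows "cs_code q L J k n l P Q =
    {mat J n (\<lambda>(b, i). \<Sum>s<k. \<Sum>a<J. m s $ a * (P * cyclic_mat L ^\<^sub>m (q ^ s * l i) * Q) $$ (a, b))
     | m. \<forall>s<k. m s \<in> carrier_vec J}"
proof -
  have "mat_of_cols J
       (map (\<lambda>i. finsum_vec TYPE('f) J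
                  (\<lambda>s. m s \<^sub>v* (P * cyclic_mat L ^\<^sub>m (q ^ s * l i) * Q)) {..<k})
            [0..<n])
     = mat J n (\<lambda>(b, i). \<Sum>s<k. \<Sum>a<J. m s $ a * (P * cyclic_mat L ^\<^sub>m (q ^ s * l i) * Q) $$ (a, b))"
    if m: "\<forall>s<k. m s \<in> carrier_vec J" for m
  proof (rule eq_matI)
    fix b i assume "b < dim_row (mat J n (\<lambda>(b, i). \<Sum>s<k. \<Sum>a<J. m s $ a * (P * cyclic_mat L ^\<^sub>m (q ^ s * l i) * Q) $$ (a, b)))"
      "i < dim_col (mat J n (\<lambda>(b, i). \<Sum>s<k. \<Sum>a<J. m s $ a * (P * cyclic_mat L ^\<^sub>m (q ^ s * l i) * Q) $$ (a, b)))"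
    then have bi: "b < J" "i < n" by auto
    let ?X = "\<lambda>s. P * cyclic_mat L ^\<^sub>m (q ^ s * l i) * Q"
    have X: "?X s \<in> carrier_mat J J" for s using assms by (intro mult_carrier_mat pow_carrier_mat) auto
    have "finsum_vec TYPE('f) J (\<lambda>s. m s \<^sub>v* ?X s) {..<k} $ b = (\<Sum>s<k. (m s \<^sub>v* ?X s) $ b)"
      using bi X by (intro index_finsum_vec) auto
    also have "\<dots> = (\<Sum>s<k. \<Sum>a<J. m s $ a * ?X s $$ (a, b))"
      using bi X[THEN carrier_matD(1)] X[THEN carrier_matD(2)] 
      by (intro sum.cong) (auto simp: mult_vec_mat_def scalar_prod_def lessThan_atLeast0)
    finally show "mat_of_cols J
       (map (\<lambda>i. finsum_vec TYPE('f) J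
                  (\<lambda>s. m s \<^sub>v* (P * cyclic_mat L ^\<^sub>m (q ^ s * l i) * Q)) {..<k})
            [0..<n]) $$ (b, i) = mat J n (\<lambda>(b, i). \<Sum>s<k. \<Sum>a<J. m s $ a * (P * cyclic_mat L ^\<^sub>m (q ^ s * l i) * Q) $$ (a, b)) $$ (b, i)"
      using bi by (simp add: mat_of_cols_index)
  qed auto
  then show ?thesis unfolding cs_code_def by (rule setcompr_cong)
qed

lemma map_mat_inv_into:
  assumes "elements_mat A \<subseteq> range \<iota>"
  shows "map_mat \<iota> (map_mat (inv_into UNIV \<iota>) A) = A"
  using assms by (intro eq_matI) (auto intro!: f_inv_into_f)

text \<open>Counts roots of x^N - x, which is nonzero because N > 1. The case N = q recognises the
  prime field; the case N = q^m finds elements of the larger field that are not fixed.\<close>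

lemma card_power_fixpoints:
  assumes "N > 1"
  shows "card {x :: 'e :: idom. x ^ N = x} \<le> N"
proof -
  define p :: "'e poly" where "p = Polynomial.monom 1 N - [:0, 1:]"
  have "Polynomial.coeff p N = 1" using assms by (simp add: p_def coeff_eq_0)
  then have p0: "p \<noteq> 0" by auto
  have "degree p \<le> N"
    unfolding p_def using assms by (intro degree_diff_le) (auto simp: degree_monom_le)
  moreover have "{x. poly p x = 0} = {x. x ^ N = x}" by (simp add: p_def poly_monom)
  ultimately show ?thesis using card_poly_roots_bound[OF p0] by simp
qed

subsection \<open>Spectral decomposition of the circular-shift operators\<close>

text \<open>\<open>J_gt_1\<close> excludes L = 1, where \<open>coprimes L\<close> is empty, so that
  1 is always an admissible index. That m is the order of q modulo L, and the MRD condition, are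
  assumed separately in the lemmas that use them.\<close>

locale circular_shift_setting =
  fixes q L m J :: nat
    and \<iota> :: "'f :: finite_field \<Rightarrow> 'k :: finite_field"
    and \<beta> :: 'k and U U' :: "'k mat" and G H :: "'f mat"
  assumes prime_q: "prime q" and L_pos: "L > 0" and coprime_q_L: "coprime q L"
    and J_eq: "J = card (coprimes L)" and J_gt_1: "J > 1"
    and card_f: "card (UNIV :: 'f set) = q" and card_k: "card (UNIV :: 'k set) = q ^ m"
    and hom: "field_hom \<iota>"
    and root: "primitive_root_of_unity L \<beta>"
    and U_carrier [simp]: "U \<in> carrier_mat J L" and U'_carrier [simp]: "U' \<in> carrier_mat J L"
    and rank_U: "vec_space.rank J (select_cols U (coprime_list L)) = J"
    and U'_eq: "transpose_mat (select_cols U' (coprime_list L))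
         = inverse (of_nat L) \<cdot>\<^sub>m the (mat_inverse (select_cols U (coprime_list L)))"
    and zero_cols: "(\<forall>j<L. j \<notin> coprimes L \<longrightarrow> col U j = 0\<^sub>v J) \<or>
         (\<forall>j<L. j \<notin> coprimes L \<longrightarrow> col U' j = 0\<^sub>v J)"
    and G_range: "elements_mat (U * V_tilde_mat L \<beta>) \<subseteq> range \<iota>"
    and H_range: "elements_mat (V_mat L \<beta> * transpose_mat U') \<subseteq> range \<iota>"
    and G_eq: "G = map_mat (inv_into UNIV \<iota>) (U * V_tilde_mat L \<beta>)"
    and H_eq: "H = map_mat (inv_into UNIV \<iota>) (V_mat L \<beta> * transpose_mat U')"
begin

sublocale field_hom \<iota> by (rule hom)

abbreviation coprime_set (\<open>\<J>\<close>) where "\<J> \<equiv> coprimes L"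

lemma CHAR_k: "CHAR('k) = q"
proof -
  have "prime CHAR('k)" by (simp add: prime_CHAR_semidom finite_imp_CHAR_pos)
  moreover have "CHAR('k) dvd q ^ m" using CHAR_dvd_CARD[where ?'a = 'k] card_k by simp
  ultimately show ?thesis using prime_q by (metis prime_dvd_power primes_dvd_imp_eq)
qed

lemma of_nat_L_nonzero: "(of_nat L :: 'k) \<noteq> 0"
proof
  assume "(of_nat L :: 'k) = 0"
  then have "q dvd L" using CHAR_k by (simp add: of_nat_eq_0_iff_char_dvd)
  then show False using coprime_q_L prime_q by (metis coprime_absorb_left not_prime_unit)
qed

lemma frobenius_sum: "(sum f A :: 'k) ^ q = (\<Sum>i\<in>A. f i ^ q)"
  by (rule freshmans_dream_sum) (use CHAR_k prime_q in auto)

lemma frobenius_range: "\<iota> x ^ q = \<iota> x"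
  using finite_field_power_card_eq_same[of x] card_f by (metis hom_power)

text \<open>The fixed points of the Frobenius contain the q elements of the image and number at most
  q. This is the descent criterion for the coefficients of \<open>tau\<close>.\<close>

lemma range_iff_frobenius: "x \<in> range \<iota> \<longleftrightarrow> x ^ q = x"
proof -
  have "q > 1" using prime_q by (rule prime_gt_1_nat)
  then have "card {x :: 'k. x ^ q = x} \<le> q" by (rule card_power_fixpoints)
  moreover have "card (range \<iota>) = q" using card_f by (simp add: card_image inj_f)
  ultimately have "card {x :: 'k. x ^ q = x} \<le> card (range \<iota>)" by simp
  moreover have "range \<iota> \<subseteq> {x. x ^ q = x}" using frobenius_range by blast
  ultimately have "range \<iota> = {x. x ^ q = x}" by (metis card_seteq finite)
  then show ?thesis by blast
qed

lemma beta_L: "\<beta> ^ L = 1"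
  using root by (simp add: primitive_root_of_unity_def)

lemma beta_pow_L: "(\<beta> ^ j) ^ L = 1"
proof -
  have "(\<beta> ^ j) ^ L = (\<beta> ^ L) ^ j" unfolding power_mult[symmetric] by (simp only: mult.commute)
  then show ?thesis by (simp add: beta_L)
qed

lemma beta_nonzero [simp]: "\<beta> \<noteq> 0"
  using root by (rule primitive_root_nonzero)

lemma beta_eq_iff: "\<beta> ^ i = \<beta> ^ j \<longleftrightarrow> [i = j] (mod L)"
  using root by (rule primitive_root_power_eq_iff)

lemma beta_diff: "j \<le> L \<Longrightarrow> \<beta> ^ (L - j) = inverse (\<beta> ^ j)"
  using beta_L by (simp add: power_diff field_simps)

lemma L_gt_1: "L > 1"
proof (rule ccontr)
  assume "\<not> ?thesis"
  then have "L = 1" using L_pos by simp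
  then have "\<J> = {}" by (auto simp: coprimes_def)
  then show False using J_gt_1 J_eq by simp
qed

lemma one_in_J [simp]: "1 \<in> \<J>"
  using L_gt_1 by (auto simp: coprimes_def)

lemma map_G: "map_mat \<iota> G = U * V_tilde_mat L \<beta>"
  unfolding G_eq using G_range by (rule map_mat_inv_into)

lemma map_H: "map_mat \<iota> H = V_mat L \<beta> * transpose_mat U'"
  unfolding H_eq using H_range by (rule map_mat_inv_into)

lemma V_carrier [simp]: "V_mat L \<beta> \<in> carrier_mat L L" "V_tilde_mat L \<beta> \<in> carrier_mat L L"
  by (auto simp: V_mat_def V_tilde_mat_def)

lemma G_carrier [simp]: "G \<in> carrier_mat J L" and H_carrier [simp]: "H \<in> carrier_mat L J"
proof -
  have "U * V_tilde_mat L \<beta> \<in> carrier_mat J L" "V_mat L \<beta> * transpose_mat U' \<in> carrier_mat L J"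
    by (auto intro!: mult_carrier_mat[of _ _ L])
  then show "G \<in> carrier_mat J L" "H \<in> carrier_mat L J" unfolding G_eq H_eq by auto
qed

text \<open>Orthogonality of characters: entry i sums the powers of the ratio beta^j / beta^i, and
  this geometric sum vanishes unless the ratio is 1.\<close>

lemma V_tilde_root_vec:
  assumes "j < L"
  shows "V_tilde_mat L \<beta> *\<^sub>v root_vec L (\<beta> ^ j) = of_nat L \<cdot>\<^sub>v unit_vec L j"
proof (rule eq_vecI)
  fix i assume "i < dim_vec (of_nat L \<cdot>\<^sub>v unit_vec L j :: 'k vec)"
  then have i: "i < L" by simp
  let ?r = "\<beta> ^ j / \<beta> ^ i"
  have "(V_tilde_mat L \<beta> *\<^sub>v root_vec L (\<beta> ^ j)) $ i = (\<Sum>d<L. ?r ^ d)"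
    unfolding index_mult_mat_vec_sum[OF V_carrier(2) root_vec_carrier i]
    using i by (intro sum.cong) (auto simp: V_tilde_mat_def power_divide power_mult field_simps)
  also have "\<dots> = (if ?r = 1 then of_nat L else 0)"
    by (rule sum_powers_root_of_unity) (simp add: power_divide beta_pow_L)
  also have "?r = 1 \<longleftrightarrow> i = j"
  proof -
    have "?r = 1 \<longleftrightarrow> \<beta> ^ j = \<beta> ^ i" by simp
    also have "\<dots> \<longleftrightarrow> j = i"
      unfolding beta_eq_iff using i assms by (auto simp: cong_def)
    finally show ?thesis by auto
  qed
  finally show "(V_tilde_mat L \<beta> *\<^sub>v root_vec L (\<beta> ^ j)) $ i = (of_nat L \<cdot>\<^sub>v unit_vec L j) $ i"
    using i assms by simp
qed (simp add: V_tilde_mat_def)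

lemma G_root_vec:
  assumes "j < L"
  shows "map_mat \<iota> G *\<^sub>v root_vec L (\<beta> ^ j) = of_nat L \<cdot>\<^sub>v col U j"
proof -
  have "map_mat \<iota> G *\<^sub>v root_vec L (\<beta> ^ j) = U *\<^sub>v (V_tilde_mat L \<beta> *\<^sub>v root_vec L (\<beta> ^ j))"
    unfolding map_G by (rule assoc_mult_mat_vec[OF U_carrier V_carrier(2) root_vec_carrier])
  also have "\<dots> = of_nat L \<cdot>\<^sub>v (U *\<^sub>v unit_vec L j)"
    unfolding V_tilde_root_vec[OF assms] by (rule mult_mat_vec[OF U_carrier unit_vec_carrier])
  also have "U *\<^sub>v unit_vec L j = col U j"
    using assms carrier_matD[OF U_carrier] by (intro eq_vecI) auto
  finally show ?thesis .
qed

text \<open>Expands a product along the columns of V, which the shift matrices merely rescale. It is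
  used with nodes beta^j for \<open>H\<close> and with their inverses for \<open>Q2\<close>.\<close>

lemma index_mult_root_cols:
  fixes A V W :: "'k mat"
  assumes A: "A \<in> carrier_mat J L" and V: "V \<in> carrier_mat L L" and W: "W \<in> carrier_mat J L"
    and cols: "\<And>j. j < L \<Longrightarrow> col V j = root_vec L (z j)"
    and "a < J" and "c < J"
  shows "(A * (V * transpose_mat W)) $$ (a, c)
    = (\<Sum>j<L. W $$ (c, j) * (A *\<^sub>v root_vec L (z j)) $ a)"
proof -
  have AV: "A * V \<in> carrier_mat J L" using A V by simp
  have "A * (V * transpose_mat W) = (A * V) * transpose_mat W"
    by (rule assoc_mult_mat[symmetric, of _ J L _ L _ J]) (use A V W in auto)
  moreover have "(X * transpose_mat W) $$ (a, c) = (\<Sum>j<L. X $$ (a, j) * W $$ (c, j))"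
    if "X \<in> carrier_mat J L" for X
    using that W assms(5,6) by (simp add: scalar_prod_def lessThan_atLeast0)
  ultimately have "(A * (V * transpose_mat W)) $$ (a, c) = (\<Sum>j<L. (A * V) $$ (a, j) * W $$ (c, j))"
    using AV by simp
  also have "\<dots> = (\<Sum>j<L. W $$ (c, j) * (A *\<^sub>v root_vec L (z j)) $ a)"
    using A V assms(5) by (intro sum.cong) (auto simp: cols mult.commute[of "W $$ _"])
  finally show ?thesis .
qed

lemma shift_root_vec:
  assumes "(z :: 'k) ^ L = 1"
  shows "(map_mat \<iota> G * cyclic_mat L ^\<^sub>m t) *\<^sub>v root_vec L z
    = z ^ t \<cdot>\<^sub>v (map_mat \<iota> G *\<^sub>v root_vec L z)"
proof -
  have "(map_mat \<iota> G * cyclic_mat L ^\<^sub>m t) *\<^sub>v root_vec L z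
      = map_mat \<iota> G *\<^sub>v (cyclic_mat L ^\<^sub>m t *\<^sub>v root_vec L z)"
    by (rule assoc_mult_mat_vec[of _ J L _ L]) (use L_pos in auto)
  also have "cyclic_mat L ^\<^sub>m t *\<^sub>v root_vec L z = z ^ t \<cdot>\<^sub>v root_vec L z"
    by (rule pow_mat_eigenvector[of _ L]) (use L_pos assms in \<open>auto simp: cyclic_mat_root_vec\<close>)
  also have "map_mat \<iota> G *\<^sub>v (z ^ t \<cdot>\<^sub>v root_vec L z) = z ^ t \<cdot>\<^sub>v (map_mat \<iota> G *\<^sub>v root_vec L z)"
    by (rule mult_mat_vec[of _ J L]) auto
  finally show ?thesis .
qed

lemma map_pow_cyclic_mat: "map_mat \<iota> (cyclic_mat L ^\<^sub>m t) = cyclic_mat L ^\<^sub>m t"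
  using mat_hom_pow[OF cyclic_mat_carrier[OF L_pos]] map_cyclic_mat[OF hom L_pos] by simp

text \<open>The columns of \<open>V_mat\<close> are eigenvectors of the shift with eigenvalues
  beta^(j t), and G sends them to L u_j. Indices not coprime to L drop out because u_j or u'_j is
  zero.\<close>

lemma index_shift_GH:
  assumes "a < J" and "c < J"
  shows "\<iota> ((G * cyclic_mat L ^\<^sub>m t * H) $$ (a, c))
    = of_nat L * (\<Sum>j\<in>\<J>. \<beta> ^ (j * t) * U $$ (a, j) * U' $$ (c, j))"
proof -
  have C: "cyclic_mat L ^\<^sub>m t \<in> carrier_mat L L" for t using L_pos by simp
  have GC: "G * cyclic_mat L ^\<^sub>m t \<in> carrier_mat J L" using C by (rule mult_carrier_mat[OF G_carrier])
  have GC': "map_mat \<iota> G * cyclic_mat L ^\<^sub>m t \<in> carrier_mat J L"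
    by (rule mult_carrier_mat[of _ J L]) (use L_pos in auto)
  have "map_mat \<iota> (G * cyclic_mat L ^\<^sub>m t * H)
      = map_mat \<iota> G * cyclic_mat L ^\<^sub>m t * (V_mat L \<beta> * transpose_mat U')"
    by (simp add: mat_hom_mult[OF GC H_carrier] mat_hom_mult[OF G_carrier C] map_H map_pow_cyclic_mat)
  moreover have "(G * cyclic_mat L ^\<^sub>m t * H) \<in> carrier_mat J J"
    by (rule mult_carrier_mat[OF GC H_carrier])
  ultimately have "\<iota> ((G * cyclic_mat L ^\<^sub>m t * H) $$ (a, c))
      = (map_mat \<iota> G * cyclic_mat L ^\<^sub>m t * (V_mat L \<beta> * transpose_mat U')) $$ (a, c)"
    using assms by (metis index_map_mat(1) carrier_matD)
  also have "\<dots> = (\<Sum>j<L. U' $$ (c, j)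
      * ((map_mat \<iota> G * cyclic_mat L ^\<^sub>m t) *\<^sub>v root_vec L (\<beta> ^ j)) $ a)"
    by (rule index_mult_root_cols[OF GC'])
      (use assms in \<open>auto simp: V_mat_def root_vec_def mult.commute simp flip: power_mult\<close>)
  also have "\<dots> = (\<Sum>j<L. of_nat L * (\<beta> ^ (j * t) * U $$ (a, j) * U' $$ (c, j)))"
  proof (rule sum.cong)
    fix j assume "j \<in> {..<L}"
    then have "((map_mat \<iota> G * cyclic_mat L ^\<^sub>m t) *\<^sub>v root_vec L (\<beta> ^ j)) $ a
        = (\<beta> ^ j) ^ t * (of_nat L * U $$ (a, j))"
      unfolding shift_root_vec[OF beta_pow_L] using assms carrier_matD[OF U_carrier]
      by (simp add: G_root_vec)
    then show "U' $$ (c, j) * ((map_mat \<iota> G * cyclic_mat L ^\<^sub>m t) *\<^sub>v root_vec L (\<beta> ^ j)) $ a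
        = of_nat L * (\<beta> ^ (j * t) * U $$ (a, j) * U' $$ (c, j))"
      by (simp add: power_mult)
  qed simp
  also have "\<dots> = (\<Sum>j\<in>\<J>. of_nat L * (\<beta> ^ (j * t) * U $$ (a, j) * U' $$ (c, j)))"
  proof (rule sum.mono_neutral_right)
    show "\<forall>j\<in>{..<L} - \<J>. of_nat L * (\<beta> ^ (j * t) * U $$ (a, j) * U' $$ (c, j)) = 0"
    proof
      fix j assume j: "j \<in> {..<L} - \<J>"
      then have "col U j = 0\<^sub>v J \<or> col U' j = 0\<^sub>v J" using zero_cols by auto
      moreover have "U $$ (a, j) = col U j $ a" "U' $$ (c, j) = col U' j $ c"
        using j assms carrier_matD[OF U_carrier] carrier_matD[OF U'_carrier] by auto
      ultimately have "U $$ (a, j) = 0 \<or> U' $$ (c, j) = 0" using assms by auto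
      then show "of_nat L * (\<beta> ^ (j * t) * U $$ (a, j) * U' $$ (c, j)) = 0" by auto
    qed
  qed (auto simp: coprimes_less)
  finally show ?thesis by (simp add: sum_distrib_left)
qed

text \<open>The hypothesis on \<open>U'\<close> is that its selected columns, scaled by L, form the
  inverse of S. The scaling cancels the inverse of L because L is nonzero in the field.\<close>

lemma biorthogonal_mats:
  defines "S \<equiv> select_cols U (coprime_list L)"
  defines "S' \<equiv> of_nat L \<cdot>\<^sub>m transpose_mat (select_cols U' (coprime_list L))"
  shows "S * S' = 1\<^sub>m J" "S' * S = 1\<^sub>m J" "S \<in> carrier_mat J J" "S' \<in> carrier_mat J J"
proof -
  show S: "S \<in> carrier_mat J J" unfolding S_def using select_cols_carrier[OF U_carrier, of "coprime_list L"] J_eq by simp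
  have "det S \<noteq> 0" using rank_U vec_space.det_rank_iff[OF S] by (simp add: S_def)
  then have "S \<in> Units (ring_mat TYPE('k) J ())" using S by (rule det_non_zero_imp_unit[rotated])
  then obtain S1 where S1: "mat_inverse S = Some S1" using mat_inverse(1)[OF S, where b = "()"] by (cases "mat_inverse S") auto
  have inv: "S * S1 = 1\<^sub>m J" "S1 * S = 1\<^sub>m J" "S1 \<in> carrier_mat J J"
    using mat_inverse(2)[OF S S1] by auto
  have "S' = S1"
    unfolding S'_def U'_eq using S1 S_def of_nat_L_nonzero inv(3)
    by (intro eq_matI) (auto simp flip: mult.assoc)
  then show "S * S' = 1\<^sub>m J" "S' * S = 1\<^sub>m J" "S' \<in> carrier_mat J J" using inv by auto
qed

lemma index_selected:
  assumes "a < J" and "i < J"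
  shows "select_cols U (coprime_list L) $$ (a, i) = U $$ (a, coprime_list L ! i)"
    and "transpose_mat (select_cols U' (coprime_list L)) $$ (i, a) = U' $$ (a, coprime_list L ! i)"
proof -
  have *: "i < length (coprime_list L)" "coprime_list L ! i < L"
    using assms J_eq by (auto simp: coprimes_less)
  show "select_cols U (coprime_list L) $$ (a, i) = U $$ (a, coprime_list L ! i)"
    by (rule index_select_cols[OF U_carrier assms(1) *])
  have "select_cols U' (coprime_list L) $$ (a, i) = U' $$ (a, coprime_list L ! i)"
    by (rule index_select_cols[OF U'_carrier assms(1) *])
  moreover have "select_cols U' (coprime_list L) \<in> carrier_mat J J"
    using select_cols_carrier[OF U'_carrier, of "coprime_list L"] J_eq by simp
  ultimately show "transpose_mat (select_cols U' (coprime_list L)) $$ (i, a) = U' $$ (a, coprime_list L ! i)"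
    using assms by simp
qed

text \<open>The product S' S gives duality of the u_j and the L u'_j. The product S S' gives, in the
  next lemma, the completeness relation that recovers a vector from its pairings.\<close>

lemma biorthogonal_cols:
  assumes "i \<in> \<J>" and "j \<in> \<J>"
  shows "of_nat L * (\<Sum>b<J. U' $$ (b, i) * U $$ (b, j)) = (if i = j then 1 else 0)"
proof -
  obtain i' j' where ij: "i' < J" "coprime_list L ! i' = i" "j' < J" "coprime_list L ! j' = j"
    using assms bij_betw_coprime_list[of L] J_eq unfolding bij_betw_def by (metis imageE lessThan_iff)
  have "i = j \<longleftrightarrow> i' = j'" using ij J_eq nth_eq_iff_index_eq[OF distinct_coprime_list, of i' L j'] by auto
  then have "(if i = j then 1 else 0) = (1\<^sub>m J :: 'k mat) $$ (i', j')" using ij by simp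
  also have "\<dots> = (\<Sum>b<J. of_nat L * (U' $$ (b, i) * U $$ (b, j)))"
    unfolding biorthogonal_mats(2)[symmetric]
    using ij carrier_matD[OF biorthogonal_mats(3)] carrier_matD[OF biorthogonal_mats(4)]
    by (simp add: scalar_prod_def lessThan_atLeast0 index_selected del: index_transpose_mat)
      (simp add: index_selected mult.assoc)
  finally show ?thesis by (simp add: sum_distrib_left)
qed

lemma biorthogonal_rows:
  assumes "a < J" and "b < J"
  shows "of_nat L * (\<Sum>j\<in>\<J>. U $$ (a, j) * U' $$ (b, j)) = (if a = b then 1 else 0)"
proof -
  have "(if a = b then 1 else 0) = (1\<^sub>m J :: 'k mat) $$ (a, b)" using assms by simp
  also have "\<dots> = (\<Sum>i<J. of_nat L * (U $$ (a, coprime_list L ! i) * U' $$ (b, coprime_list L ! i)))"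
    unfolding biorthogonal_mats(1)[symmetric]
    using assms carrier_matD[OF biorthogonal_mats(3)] carrier_matD[OF biorthogonal_mats(4)]
    by (simp add: scalar_prod_def lessThan_atLeast0 index_selected del: index_transpose_mat)
      (simp add: index_selected mult_ac)
  also have "\<dots> = (\<Sum>j\<in>\<J>. of_nat L * (U $$ (a, j) * U' $$ (b, j)))"
    unfolding J_eq by (rule sum_coprime_list)
  finally show ?thesis by (simp add: sum_distrib_left)
qed

section \<open>The polynomial tau and its descent to the prime field\<close>

lemma poly_tau: "poly (tau L \<beta>) x = (\<Prod>j\<in>{0..<L} - \<J>. x - \<beta> ^ j)"
  by (simp add: tau_def poly_prod)

lemma poly_tau_zero: "j < L \<Longrightarrow> j \<notin> \<J> \<Longrightarrow> poly (tau L \<beta>) (\<beta> ^ j) = 0"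
  by (auto simp: poly_tau)

lemma poly_tau_nonzero:
  assumes "j \<in> \<J>"
  shows "poly (tau L \<beta>) (\<beta> ^ j) \<noteq> 0"
proof -
  have "\<beta> ^ j \<noteq> \<beta> ^ i" if "i \<in> {0..<L} - \<J>" for i
    unfolding beta_eq_iff using that assms coprimes_less[OF assms] by (auto simp: cong_def)
  then show ?thesis by (simp add: poly_tau)
qed

text \<open>Multiplication by q is injective modulo L and creates no coprimality to L. Hence the
  Frobenius permutes the roots of \<open>tau\<close>.\<close>

lemma bij_betw_mult_q: "bij_betw (\<lambda>j. q * j mod L) ({0..<L} - \<J>) ({0..<L} - \<J>)"
proof -
  have inj: "inj_on (\<lambda>j. q * j mod L) ({0..<L} - \<J>)"
  proof (rule inj_onI)
    fix i j assume "i \<in> {0..<L} - \<J>" "j \<in> {0..<L} - \<J>" "q * i mod L = q * j mod L"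
    then show "i = j"
      using cong_mult_lcancel_nat[of q L i j] coprime_q_L by (auto simp: cong_def)
  qed
  moreover have "q * j mod L \<notin> \<J>" if "j \<in> {0..<L} - \<J>" for j
  proof
    assume "q * j mod L \<in> \<J>"
    then have "coprime j L" "j \<noteq> 0" by (cases "j = 0"; auto simp: coprimes_def)+
    then show False using that by (auto simp: coprimes_def)
  qed
  then have "(\<lambda>j. q * j mod L) ` ({0..<L} - \<J>) \<subseteq> {0..<L} - \<J>" using L_pos by auto
  ultimately show ?thesis unfolding bij_betw_def by (simp add: endo_inj_surj)
qed

abbreviation "tau_f \<equiv> map_poly (inv_into UNIV \<iota>) (tau L \<beta>)"

text \<open>The Frobenius on coefficients permutes the linear factors, so every coefficient is fixed
  and lies in the image of \<iota>, where \<open>inv_into\<close> gives a genuine preimage.\<close>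

lemma map_tau: "map_poly \<iota> tau_f = tau L \<beta>"
proof -
  have q0: "q > 0" using prime_q by (rule prime_gt_0_nat)
  have add: "(x + y) ^ q = x ^ q + y ^ q" for x y :: 'k
    by (rule freshmans_dream) (simp_all add: CHAR_k prime_q)
  interpret Fr: comm_ring_hom "\<lambda>x :: 'k. x ^ q"
    by unfold_locales (use q0 in \<open>simp_all add: add power_mult_distrib\<close>)
  interpret FrP: map_poly_comm_ring_hom "\<lambda>x :: 'k. x ^ q" ..
  have "map_poly (\<lambda>x. x ^ q) (tau L \<beta>) = (\<Prod>j\<in>{0..<L} - \<J>. [:- (\<beta> ^ (q * j mod L)), 1:])"
  proof -
    have "map_poly (\<lambda>x. x ^ q) [:- (\<beta> ^ j), 1:] = [:- (\<beta> ^ (q * j mod L)), 1:]" for j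
    proof -
      have "(- (\<beta> ^ j)) ^ q = - (\<beta> ^ (q * j mod L))"
        by (simp add: Fr.hom_uminus power_mod_eq[OF beta_L] mult.commute[of q] power_mult)
      then show ?thesis by (simp add: map_poly_pCons)
    qed
    then show ?thesis by (simp add: tau_def FrP.hom_prod)
  qed
  also have "\<dots> = tau L \<beta>"
    unfolding tau_def by (rule prod.reindex_bij_betw[OF bij_betw_mult_q])
  finally have "(Polynomial.coeff (tau L \<beta>) i) ^ q = Polynomial.coeff (tau L \<beta>) i" for i
    using q0 by (metis Fr.hom_zero coeff_map_poly)
  then have "\<iota> (inv_into UNIV \<iota> (Polynomial.coeff (tau L \<beta>) i)) = Polynomial.coeff (tau L \<beta>) i" for i
    by (intro f_inv_into_f) (simp add: range_iff_frobenius)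
  \<comment> \<open>\<open>coeff_map_poly\<close> asks for a function with value 0 at 0.\<close>
  moreover have "inv_into UNIV \<iota> 0 = 0" using inv_f_f[of 0] by simp
  ultimately show ?thesis
    by (intro poly_eqI) (simp add: coeff_map_poly)
qed

abbreviation "Q2 \<equiv> poly_mat tau_f (cyclic_mat L) * transpose_mat G"

lemma Q2_carrier [simp]: "Q2 \<in> carrier_mat L J"
  using L_pos by (intro mult_carrier_mat[of _ _ L]) auto

lemma map_Q2:
  "map_mat \<iota> Q2 = poly_mat (tau L \<beta>) (cyclic_mat L) * (transpose_mat (V_tilde_mat L \<beta>) * transpose_mat U)"
proof -
  have "map_mat \<iota> (transpose_mat G) = transpose_mat (map_mat \<iota> G)" by (rule eq_matI) auto
  also have "\<dots> = transpose_mat (V_tilde_mat L \<beta>) * transpose_mat U"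
    unfolding map_G by (rule transpose_mult[OF U_carrier V_carrier(2)])
  finally have GT: "map_mat \<iota> (transpose_mat G) = transpose_mat (V_tilde_mat L \<beta>) * transpose_mat U" .
  have p: "poly_mat tau_f (cyclic_mat L) \<in> carrier_mat L L" using L_pos by simp
  have "transpose_mat G \<in> carrier_mat L J" by simp
  then have "map_mat \<iota> Q2 = map_mat \<iota> (poly_mat tau_f (cyclic_mat L)) * map_mat \<iota> (transpose_mat G)"
    by (rule mat_hom_mult[OF p])
  then show ?thesis
    unfolding GT map_poly_mat[OF hom cyclic_mat_carrier[OF L_pos]] map_tau map_cyclic_mat[OF hom L_pos] .
qed

text \<open>The columns of the transposed \<open>V_tilde_mat\<close> belong to the eigenvalues
  beta^(L-j), on which tau(C_L) acts as the scalar tau(beta^(L-j)); it vanishes when j is not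
  coprime to L. Reflecting j to L - j then gives the sum the shape of the formula for
  \<open>H\<close>.\<close>

lemma index_shift_GQ2:
  assumes "a < J" and "c < J"
  shows "\<iota> ((G * cyclic_mat L ^\<^sub>m t * Q2) $$ (a, c))
    = of_nat L * (\<Sum>j\<in>\<J>. \<beta> ^ (j * t) * poly (tau L \<beta>) (\<beta> ^ j) * U $$ (a, j) * U $$ (c, L - j))"
proof -
  let ?\<tau> = "poly (tau L \<beta>)"
  let ?A = "map_mat \<iota> G * cyclic_mat L ^\<^sub>m t :: 'k mat"
  let ?P = "poly_mat (tau L \<beta>) (cyclic_mat L)"
  have C: "cyclic_mat L ^\<^sub>m t \<in> carrier_mat L L" using L_pos by simp
  have GC: "G * cyclic_mat L ^\<^sub>m t \<in> carrier_mat J L" by (rule mult_carrier_mat[OF G_carrier C])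
  have A: "?A \<in> carrier_mat J L" by (rule mult_carrier_mat[of _ J L]) (use L_pos in auto)
  have P: "?P \<in> carrier_mat L L" using L_pos by simp
  have W: "transpose_mat (V_tilde_mat L \<beta>) * transpose_mat U \<in> carrier_mat L J"
    by (rule mult_carrier_mat[of _ L L]) auto
  have "map_mat \<iota> (G * cyclic_mat L ^\<^sub>m t * Q2)
      = ?A * (?P * (transpose_mat (V_tilde_mat L \<beta>) * transpose_mat U))"
    unfolding mat_hom_mult[OF GC Q2_carrier] mat_hom_mult[OF G_carrier C] map_Q2 map_pow_cyclic_mat ..
  also have "\<dots> = ?A * ?P * (transpose_mat (V_tilde_mat L \<beta>) * transpose_mat U)"
    by (rule assoc_mult_mat[OF A P W, symmetric])
  finally have map: "map_mat \<iota> (G * cyclic_mat L ^\<^sub>m t * Q2)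
      = ?A * ?P * (transpose_mat (V_tilde_mat L \<beta>) * transpose_mat U)" .
  have "(G * cyclic_mat L ^\<^sub>m t * Q2) \<in> carrier_mat J J"
    by (rule mult_carrier_mat[OF GC Q2_carrier])
  then have "\<iota> ((G * cyclic_mat L ^\<^sub>m t * Q2) $$ (a, c))
      = (?A * ?P * (transpose_mat (V_tilde_mat L \<beta>) * transpose_mat U)) $$ (a, c)"
    using assms map by (metis index_map_mat(1) carrier_matD)
  also have "\<dots> = (\<Sum>j<L. U $$ (c, j) * ((?A * ?P) *\<^sub>v root_vec L (inverse (\<beta> ^ j))) $ a)"
    by (rule index_mult_root_cols)
      (use assms mult_carrier_mat[OF A P] in
        \<open>auto simp: V_tilde_mat_def root_vec_def power_mult power_inverse\<close>)
  also have "\<dots> = (\<Sum>j<L. if j \<in> \<J> then U $$ (c, j) * ((\<beta> ^ (L - j)) ^ t * ?\<tau> (\<beta> ^ (L - j))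
      * (of_nat L * U $$ (a, L - j))) else 0)"
  proof (rule sum.cong)
    fix j assume "j \<in> {..<L}"
    then have j: "j < L" by simp
    let ?z = "\<beta> ^ (L - j)"
    have z: "inverse (\<beta> ^ j) = ?z" using j by (simp add: beta_diff)
    have "(?A * ?P) *\<^sub>v root_vec L ?z = ?A *\<^sub>v (?P *\<^sub>v root_vec L ?z)"
      by (rule assoc_mult_mat_vec[OF A P root_vec_carrier])
    also have "?P *\<^sub>v root_vec L ?z = ?\<tau> ?z \<cdot>\<^sub>v root_vec L ?z"
      using L_pos beta_pow_L
      by (intro poly_mat_eigenvector[of _ L]) (auto simp: cyclic_mat_root_vec)
    also have "?A *\<^sub>v (?\<tau> ?z \<cdot>\<^sub>v root_vec L ?z) = ?\<tau> ?z \<cdot>\<^sub>v (?A *\<^sub>v root_vec L ?z)"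
      by (rule mult_mat_vec[OF A root_vec_carrier])
    also have "\<dots> = ?\<tau> ?z \<cdot>\<^sub>v (?z ^ t \<cdot>\<^sub>v (map_mat \<iota> G *\<^sub>v root_vec L ?z))"
      unfolding shift_root_vec[OF beta_pow_L] ..
    finally have e: "((?A * ?P) *\<^sub>v root_vec L ?z) $ a
        = ?\<tau> ?z * (?z ^ t * (map_mat \<iota> G *\<^sub>v root_vec L ?z) $ a)"
      using assms carrier_matD[OF G_carrier] by simp
    show "U $$ (c, j) * ((?A * ?P) *\<^sub>v root_vec L (inverse (\<beta> ^ j))) $ a
      = (if j \<in> \<J> then U $$ (c, j) * (?z ^ t * ?\<tau> ?z * (of_nat L * U $$ (a, L - j))) else 0)"
    proof (cases "j \<in> \<J>")
      case True
      then have "L - j < L" by (auto simp: coprimes_def)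
      then have "(map_mat \<iota> G *\<^sub>v root_vec L ?z) $ a = of_nat L * U $$ (a, L - j)"
        using assms carrier_matD[OF U_carrier] by (simp add: G_root_vec)
      then show ?thesis using True unfolding z e by simp
    next
      case False
      have "?\<tau> ?z = 0"
      \<comment> \<open>For j = 0 the index L - j is L, which is out of range, but beta^L = beta^0
        and 0 is not in the index set.\<close>
      proof (cases "j = 0")
        case True
        then show ?thesis using poly_tau_zero[of 0] L_pos beta_L by (auto simp: coprimes_def)
      next
        case j0: False
        then have "L - j \<notin> \<J>" using False j coprimes_diff[of "L - j" L] by auto
        then show ?thesis using j j0 by (intro poly_tau_zero) auto
      qed
      then show ?thesis using False unfolding z e by simp
    qed
  qed simp
  also have "\<dots> = (\<Sum>j\<in>{..<L} \<inter> \<J>. U $$ (c, j) * ((\<beta> ^ (L - j)) ^ t * ?\<tau> (\<beta> ^ (L - j))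
      * (of_nat L * U $$ (a, L - j))))"
    by (simp add: sum.inter_restrict)
  also have "{..<L} \<inter> \<J> = \<J>" by (auto simp: coprimes_less)
  \<comment> \<open>Writing j as L - (L - j) exhibits the summand as a function of L - j, ready for
    the reflection.\<close>
  also have "(\<Sum>j\<in>\<J>. U $$ (c, j) * ((\<beta> ^ (L - j)) ^ t * ?\<tau> (\<beta> ^ (L - j)) * (of_nat L * U $$ (a, L - j))))
    = (\<Sum>j\<in>\<J>. U $$ (c, L - (L - j)) * ((\<beta> ^ (L - j)) ^ t * ?\<tau> (\<beta> ^ (L - j)) * (of_nat L * U $$ (a, L - j))))"
    by (intro sum.cong) (auto dest: coprimes_less)
  also have "\<dots> = (\<Sum>j\<in>\<J>. U $$ (c, L - j) * ((\<beta> ^ j) ^ t * ?\<tau> (\<beta> ^ j) * (of_nat L * U $$ (a, j))))"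
    using sum.reindex_bij_betw[OF bij_betw_coprimes_diff,
        of "\<lambda>j. U $$ (c, L - j) * ((\<beta> ^ j) ^ t * ?\<tau> (\<beta> ^ j) * (of_nat L * U $$ (a, j)))"] .
  finally show ?thesis by (simp add: sum_distrib_left mult_ac power_mult)
qed

section \<open>The matrix T that carries the first code to the second\<close>

abbreviation "T \<equiv> T_mat L \<beta> U"

lemma T_carrier [simp]: "T \<in> carrier_mat J J"
  by (rule carrier_matI) (use carrier_matD[OF U_carrier] J_eq in \<open>simp_all add: T_mat_def select_cols_def\<close>)

lemma index_T:
  assumes "c < J" and "b < J"
  shows "T $$ (c, b) = of_nat L * (\<Sum>j\<in>\<J>. U $$ (c, L - j) * poly (tau L \<beta>) (\<beta> ^ j) * U $$ (b, j))"
proof -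
  let ?S1 = "select_cols U (map (\<lambda>j. L - j) (coprime_list L))" and ?S = "select_cols U (coprime_list L)"
  let ?d = "\<lambda>i. poly (tau L \<beta>) (\<beta> ^ (coprime_list L ! i))"
  have S1: "?S1 \<in> carrier_mat J J"
    using select_cols_carrier[OF U_carrier, of "map (\<lambda>j. L - j) (coprime_list L)"] J_eq by simp
  have S: "?S \<in> carrier_mat J J"
    using select_cols_carrier[OF U_carrier, of "coprime_list L"] J_eq by simp
  have i1: "?S1 $$ (c, i) = U $$ (c, L - coprime_list L ! i)" if "i < J" for i
    using that assms(1) J_eq coprimes_diff[OF coprime_list_nth, of i L] coprimes_less
    by (subst index_select_cols[OF U_carrier]) auto
  have "T $$ (c, b) = of_nat L * (\<Sum>i<J. ?S1 $$ (c, i) * ?d i * ?S $$ (b, i))"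
    unfolding T_mat_def J_eq[symmetric] mat_diag_mult_right[OF S1]
    using assms S1 S by (simp add: scalar_prod_def lessThan_atLeast0)
  also have "\<dots> = of_nat L * (\<Sum>i<J. U $$ (c, L - coprime_list L ! i) * ?d i * U $$ (b, coprime_list L ! i))"
    using assms by (simp add: i1 index_selected)
  also have "\<dots> = of_nat L * (\<Sum>j\<in>\<J>. U $$ (c, L - j) * poly (tau L \<beta>) (\<beta> ^ j) * U $$ (b, j))"
    unfolding J_eq
    by (subst sum_coprime_list[of "\<lambda>j. U $$ (c, L - j) * poly (tau L \<beta>) (\<beta> ^ j) * U $$ (b, j)"]) simp
  finally show ?thesis .
qed

text \<open>With shift 0 all factors beta^(j t) are 1, and \<open>index_shift_GQ2\<close> becomes
  the transposed formula of \<open>index_T\<close>. This is how \<open>T\<close> is seen to have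
  entries in the prime field.\<close>

definition "T_f = transpose_mat (G * cyclic_mat L ^\<^sub>m 0 * Q2)"

lemma T_f_carrier [simp]: "T_f \<in> carrier_mat J J"
proof -
  have "G * cyclic_mat L ^\<^sub>m 0 * Q2 \<in> carrier_mat J J"
    by (intro mult_carrier_mat[OF _ Q2_carrier] mult_carrier_mat[OF G_carrier] pow_carrier_mat cyclic_mat_carrier L_pos)
  then show ?thesis unfolding T_f_def by simp
qed

lemma map_T_f: "map_mat \<iota> T_f = T"
proof (rule eq_matI)
  have c: "G * cyclic_mat L ^\<^sub>m 0 * Q2 \<in> carrier_mat J J"
    by (intro mult_carrier_mat[OF _ Q2_carrier] mult_carrier_mat[OF G_carrier] pow_carrier_mat cyclic_mat_carrier L_pos)
  fix a b assume "a < dim_row T" "b < dim_col T"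
  then have ab: "a < J" "b < J" using carrier_matD[OF T_carrier] by auto
  then have "map_mat \<iota> T_f $$ (a, b) = \<iota> ((G * cyclic_mat L ^\<^sub>m 0 * Q2) $$ (b, a))"
    unfolding T_f_def using carrier_matD[OF c] by simp
  also have "\<dots> = T $$ (a, b)"
    unfolding index_shift_GQ2[OF ab(2,1)] index_T[OF ab] by (simp add: mult_ac)
  finally show "map_mat \<iota> T_f $$ (a, b) = T $$ (a, b)" .
qed (use carrier_matD[OF T_carrier] carrier_matD[OF T_f_carrier] in auto)

text \<open>Pairing with the dual vector L u'_j leaves only the summand j of \<open>T\<close>, so
  \<open>T\<close> sends u'_j to tau(beta^j) u_(L-j).\<close>

lemma T_mult_U':
  assumes "c < J" and j: "j \<in> \<J>"
  shows "of_nat L * (\<Sum>b<J. U' $$ (b, j) * T $$ (c, b))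
    = of_nat L * U $$ (c, L - j) * poly (tau L \<beta>) (\<beta> ^ j)"
proof -
  let ?\<tau> = "\<lambda>j. poly (tau L \<beta>) (\<beta> ^ j)"
  have "of_nat L * (\<Sum>b<J. U' $$ (b, j) * T $$ (c, b))
      = (\<Sum>b<J. \<Sum>i\<in>\<J>. of_nat L * U $$ (c, L - i) * ?\<tau> i * (of_nat L * (U' $$ (b, j) * U $$ (b, i))))"
    unfolding sum_distrib_left
    by (intro sum.cong refl) (use assms in \<open>simp add: index_T sum_distrib_left mult_ac\<close>)
  also have "\<dots> = (\<Sum>i\<in>\<J>. of_nat L * U $$ (c, L - i) * ?\<tau> i * (of_nat L * (\<Sum>b<J. U' $$ (b, j) * U $$ (b, i))))"
    by (subst sum.swap) (simp add: sum_distrib_left)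
  also have "\<dots> = (\<Sum>i\<in>\<J>. if j = i then of_nat L * U $$ (c, L - i) * ?\<tau> i else 0)"
    by (intro sum.cong) (auto simp: biorthogonal_cols[OF j])
  finally show ?thesis using j by simp
qed

text \<open>\<open>T\<close> turns each u'_j in the formula for \<open>H\<close> into the vector in
  the formula for \<open>Q2\<close>. Hence replacing \<open>H\<close> by \<open>Q2\<close> is right
  multiplication by the transpose of \<open>T_f\<close>; the two sides are compared after applying
  \<iota>.\<close>

lemma index_shift_GQ2_eq:
  assumes "a < J" and "c < J"
  shows "(G * cyclic_mat L ^\<^sub>m t * Q2) $$ (a, c)
    = (\<Sum>b<J. (G * cyclic_mat L ^\<^sub>m t * H) $$ (a, b) * T_f $$ (c, b))"
proof -
  have T: "\<iota> (T_f $$ (c, b)) = T $$ (c, b)" if "b < J" for b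
    using that assms carrier_matD[OF T_f_carrier] by (simp flip: map_T_f)
  have "\<iota> (\<Sum>b<J. (G * cyclic_mat L ^\<^sub>m t * H) $$ (a, b) * T_f $$ (c, b))
      = (\<Sum>b<J. (\<Sum>j\<in>\<J>. \<beta> ^ (j * t) * U $$ (a, j) * (of_nat L * (U' $$ (b, j) * T $$ (c, b)))))"
    unfolding hom_sum
    by (intro sum.cong refl)
      (use assms T in \<open>simp add: hom_mult index_shift_GH sum_distrib_left sum_distrib_right mult_ac\<close>)
  also have "\<dots> = (\<Sum>j\<in>\<J>. \<beta> ^ (j * t) * U $$ (a, j) * (of_nat L * (\<Sum>b<J. U' $$ (b, j) * T $$ (c, b))))"
    by (subst sum.swap) (simp add: sum_distrib_left)
  also have "\<dots> = (\<Sum>j\<in>\<J>. \<beta> ^ (j * t) * U $$ (a, j) * (of_nat L * U $$ (c, L - j) * poly (tau L \<beta>) (\<beta> ^ j)))"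
    by (intro sum.cong refl) (simp add: T_mult_U'[OF assms(2)])
  also have "\<dots> = \<iota> ((G * cyclic_mat L ^\<^sub>m t * Q2) $$ (a, c))"
    unfolding index_shift_GQ2[OF assms] by (simp add: sum_distrib_left mult_ac)
  finally show ?thesis by (rule injD[OF inj_f, THEN sym])
qed

lemma T_right_inverse:
  obtains R where "R \<in> carrier_mat J J" and "T * R = 1\<^sub>m J"
proof -
  let ?\<tau> = "\<lambda>j. poly (tau L \<beta>) (\<beta> ^ j)"
  \<comment> \<open>Inverts \<open>T\<close> on the eigenbasis: R sends u_(L-j) to u'_j /
    tau(beta^j), the dual vector of u_(L-j) being L u'_(L-j).\<close>
  define R where "R = mat J J (\<lambda>(b, d). of_nat L * (\<Sum>j\<in>\<J>. U' $$ (b, j) * (U' $$ (d, L - j) / ?\<tau> j)))"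
  have R: "R \<in> carrier_mat J J" by (simp add: R_def)
  have "T * R = 1\<^sub>m J"
  proof (rule eq_matI)
    fix c d assume "c < dim_row (1\<^sub>m J :: 'k mat)" "d < dim_col (1\<^sub>m J :: 'k mat)"
    then have cd: "c < J" "d < J" by auto
    have "(T * R) $$ (c, d) = (\<Sum>b<J. T $$ (c, b) * R $$ (b, d))"
      using cd carrier_matD[OF T_carrier] carrier_matD[OF R]
      by (simp add: scalar_prod_def lessThan_atLeast0)
    also have "\<dots> = (\<Sum>b<J. \<Sum>j\<in>\<J>. (of_nat L * (U' $$ (b, j) * T $$ (c, b))) * (U' $$ (d, L - j) / ?\<tau> j))"
      using cd by (intro sum.cong refl) (simp add: R_def sum_distrib_left mult_ac)
    also have "\<dots> = (\<Sum>j\<in>\<J>. (of_nat L * (\<Sum>b<J. U' $$ (b, j) * T $$ (c, b))) * (U' $$ (d, L - j) / ?\<tau> j))"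
      by (subst sum.swap) (simp add: sum_distrib_left sum_distrib_right sum_divide_distrib)
    also have "\<dots> = (\<Sum>j\<in>\<J>. of_nat L * (U $$ (c, L - j) * U' $$ (d, L - j)))"
      by (intro sum.cong refl) (simp add: T_mult_U'[OF cd(1)] poly_tau_nonzero)
    also have "\<dots> = (\<Sum>j\<in>\<J>. of_nat L * (U $$ (c, j) * U' $$ (d, j)))"
      using sum.reindex_bij_betw[OF bij_betw_coprimes_diff] .
    also have "\<dots> = (1\<^sub>m J) $$ (c, d)"
      using cd biorthogonal_rows[OF cd] by (simp add: sum_distrib_left)
    finally show "(T * R) $$ (c, d) = (1\<^sub>m J) $$ (c, d)" .
  qed (use carrier_matD[OF T_carrier] carrier_matD[OF R] in auto)
  with R show ?thesis by (rule that)
qed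

text \<open>The determinant of \<open>T\<close> is the image of that of \<open>T_f\<close>, so
  invertibility over the extension already gives an inverse over the prime field.\<close>

lemma T_f_inverse:
  obtains R where "R \<in> carrier_mat J J" and "T_f * R = 1\<^sub>m J" and "R * T_f = 1\<^sub>m J"
    and "mat_inverse T = Some (map_mat \<iota> R)"
proof -
  obtain R' where R': "R' \<in> carrier_mat J J" "T * R' = 1\<^sub>m J" by (rule T_right_inverse)
  have "det T * det R' = 1" using det_mult[OF T_carrier R'(1)] R'(2) by simp
  then have "det T \<noteq> 0" by auto
  moreover have "det T = \<iota> (det T_f)" by (simp flip: map_T_f)
  ultimately have "det T_f \<noteq> 0" by auto
  then obtain R where R: "R \<in> carrier_mat J J" "T_f * R = 1\<^sub>m J" "R * T_f = 1\<^sub>m J"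
    by (rule det_nonzero_obtain_inverse[OF T_f_carrier])
  have "T * map_mat \<iota> R = map_mat \<iota> (T_f * R)"
    unfolding map_T_f[symmetric] by (rule mat_hom_mult[OF T_f_carrier R(1), symmetric])
  then have "T * map_mat \<iota> R = 1\<^sub>m J" using R(2) by (simp add: mat_hom_one)
  then have "mat_inverse T = Some (map_mat \<iota> R)"
    using R(1) by (intro mat_inverse_eqI[OF T_carrier]) auto
  with R show ?thesis by (rule that)
qed

text \<open>The row vectors c_i become the columns of a codeword, so right multiplication by the
  transpose of \<open>T_f\<close> turns into left multiplication by \<open>T_f\<close>.\<close>

lemma cs_code_Q2: "cs_code q L J k n l G Q2 = (*) T_f ` cs_code q L J k n l G H"
proof -
  let ?M = "\<lambda>Q m. mat J n (\<lambda>(b, i). \<Sum>s<k. \<Sum>a<J. m s $ a * (G * cyclic_mat L ^\<^sub>m (q ^ s * l i) * Q) $$ (a, b))"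
  have "?M Q2 m = T_f * ?M H m" for m
  proof (rule eq_matI)
    fix c i assume "c < dim_row (T_f * ?M H m)" "i < dim_col (T_f * ?M H m)"
    then have ci: "c < J" "i < n" using carrier_matD[OF T_f_carrier] by auto
    let ?X = "\<lambda>s. G * cyclic_mat L ^\<^sub>m (q ^ s * l i) * H"
    have "(T_f * ?M H m) $$ (c, i) = (\<Sum>b<J. T_f $$ (c, b) * (\<Sum>s<k. \<Sum>a<J. m s $ a * ?X s $$ (a, b)))"
      using ci carrier_matD[OF T_f_carrier] by (simp add: scalar_prod_def lessThan_atLeast0)
    also have "\<dots> = (\<Sum>s<k. \<Sum>b<J. \<Sum>a<J. m s $ a * (?X s $$ (a, b) * T_f $$ (c, b)))"
      unfolding sum_distrib_left by (subst sum.swap) (simp add: mult_ac)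
    also have "\<dots> = (\<Sum>s<k. \<Sum>a<J. m s $ a * (\<Sum>b<J. ?X s $$ (a, b) * T_f $$ (c, b)))"
      unfolding sum_distrib_left by (intro sum.cong refl sum.swap)
    also have "\<dots> = ?M Q2 m $$ (c, i)"
      using ci by (simp add: index_shift_GQ2_eq[OF _ ci(1)])
    finally show "?M Q2 m $$ (c, i) = (T_f * ?M H m) $$ (c, i)" ..
  qed (use carrier_matD[OF T_f_carrier] in auto)
  then show ?thesis
    unfolding cs_code_eq[OF G_carrier H_carrier L_pos] cs_code_eq[OF G_carrier Q2_carrier L_pos]
    by auto
qed

section \<open>Components of codewords along the eigenvectors u_j\<close>

lemma shift_GH_mult_U:
  assumes "a < J" and j: "j \<in> \<J>"
  shows "(\<Sum>b<J. \<iota> ((G * cyclic_mat L ^\<^sub>m t * H) $$ (a, b)) * U $$ (b, j)) = \<beta> ^ (j * t) * U $$ (a, j)"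
proof -
  have "(\<Sum>b<J. \<iota> ((G * cyclic_mat L ^\<^sub>m t * H) $$ (a, b)) * U $$ (b, j))
      = (\<Sum>b<J. \<Sum>i\<in>\<J>. \<beta> ^ (i * t) * U $$ (a, i) * (of_nat L * (U' $$ (b, i) * U $$ (b, j))))"
    using assms by (intro sum.cong refl) (simp add: index_shift_GH sum_distrib_left sum_distrib_right mult_ac)
  also have "\<dots> = (\<Sum>i\<in>\<J>. \<beta> ^ (i * t) * U $$ (a, i) * (of_nat L * (\<Sum>b<J. U' $$ (b, i) * U $$ (b, j))))"
    by (subst sum.swap) (simp add: sum_distrib_left)
  also have "\<dots> = (\<Sum>i\<in>\<J>. if i = j then \<beta> ^ (i * t) * U $$ (a, i) else 0)"
    by (intro sum.cong) (auto simp: biorthogonal_cols[OF _ j])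
  finally show ?thesis using j by simp
qed

text \<open>As u_j is a right eigenvector of every G C_L^t H, the message w_s enters the component
  along u_j only through the scalar w_s u_j.\<close>

lemma cs_code_row:
  fixes l :: "nat \<Rightarrow> nat" and w :: "nat \<Rightarrow> 'f vec"
  assumes w: "\<And>s. s < k \<Longrightarrow> w s \<in> carrier_vec J" and i: "i < n" and j: "j \<in> \<J>"
  defines "M \<equiv> mat J n (\<lambda>(b, i). \<Sum>s<k. \<Sum>a<J. w s $ a * (G * cyclic_mat L ^\<^sub>m (q ^ s * l i) * H) $$ (a, b))"
  shows "(\<Sum>b<J. U $$ (b, j) * \<iota> (M $$ (b, i)))
    = (\<Sum>s<k. (\<Sum>a<J. \<iota> (w s $ a) * U $$ (a, j)) * \<beta> ^ (j * (q ^ s * l i)))"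
proof -
  let ?X = "\<lambda>s. G * cyclic_mat L ^\<^sub>m (q ^ s * l i) * H"
  have "(\<Sum>b<J. U $$ (b, j) * \<iota> (M $$ (b, i)))
      = (\<Sum>b<J. \<Sum>s<k. \<Sum>a<J. \<iota> (w s $ a) * (\<iota> (?X s $$ (a, b)) * U $$ (b, j)))"
    using i by (intro sum.cong refl) (simp add: M_def hom_sum hom_mult sum_distrib_left mult_ac)
  also have "\<dots> = (\<Sum>s<k. \<Sum>b<J. \<Sum>a<J. \<iota> (w s $ a) * (\<iota> (?X s $$ (a, b)) * U $$ (b, j)))"
    by (rule sum.swap)
  also have "\<dots> = (\<Sum>s<k. \<Sum>a<J. \<iota> (w s $ a) * (\<Sum>b<J. \<iota> (?X s $$ (a, b)) * U $$ (b, j)))"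
    unfolding sum_distrib_left by (intro sum.cong refl sum.swap)
  also have "\<dots> = (\<Sum>s<k. (\<Sum>a<J. \<iota> (w s $ a) * U $$ (a, j)) * \<beta> ^ (j * (q ^ s * l i)))"
    unfolding sum_distrib_right by (intro sum.cong refl) (subst shift_GH_mult_U; use j in \<open>simp add: mult_ac\<close>)
  finally show ?thesis .
qed

subsection \<open>The case \<open>J = m\<close>\<close>

text \<open>The completeness relation recovers each coefficient from the pairings with all
  u_j.\<close>

lemma U_rows_independent:
  assumes "\<And>j. j \<in> \<J> \<Longrightarrow> (\<Sum>a<J. x a * U $$ (a, j)) = 0" and "a < J"
  shows "x a = 0"
proof -
  have "x a = (\<Sum>b<J. if b = a then x b else 0)" using assms(2) by simp
  also have "\<dots> = (\<Sum>b<J. x b * (of_nat L * (\<Sum>j\<in>\<J>. U $$ (b, j) * U' $$ (a, j))))"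
    using assms(2) by (intro sum.cong) (auto simp: biorthogonal_rows)
  also have "\<dots> = (\<Sum>j\<in>\<J>. of_nat L * U' $$ (a, j) * (\<Sum>b<J. x b * U $$ (b, j)))"
    unfolding sum_distrib_left by (subst sum.swap) (simp add: mult_ac)
  also have "\<dots> = 0" using assms(1) by simp
  finally show ?thesis .
qed

text \<open>L u_j is G applied to the powers of beta^j. The entries of G and the integer L are fixed
  by the Frobenius, so only the exponent j changes, to q j.\<close>

lemma frobenius_U:
  assumes "a < J" and "j < L"
  shows "U $$ (a, j) ^ q = U $$ (a, q * j mod L)"
proof -
  have e: "of_nat L * U $$ (a, j) = (\<Sum>b<L. \<iota> (G $$ (a, b)) * \<beta> ^ (j * b))" if "j < L" for j
  proof -
    have "of_nat L * U $$ (a, j) = (map_mat \<iota> G *\<^sub>v root_vec L (\<beta> ^ j)) $ a"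
      unfolding G_root_vec[OF that] using assms(1) that carrier_matD[OF U_carrier] by simp
    also have "\<dots> = (\<Sum>b<L. map_mat \<iota> G $$ (a, b) * root_vec L (\<beta> ^ j) $ b)"
      by (rule index_mult_mat_vec_sum[of _ J]) (use assms in auto)
    finally show ?thesis
      using assms(1) carrier_matD[OF G_carrier] by (simp add: power_mult)
  qed
  have "of_nat L * U $$ (a, j) ^ q = (of_nat L * U $$ (a, j)) ^ q"
    using frobenius_range[of "of_nat L"] by (simp add: power_mult_distrib hom_distribs)
  also have "\<dots> = (\<Sum>b<L. \<iota> (G $$ (a, b)) * \<beta> ^ (q * j * b))"
    unfolding e[OF assms(2)] frobenius_sum
    by (simp add: power_mult_distrib frobenius_range mult_ac flip: power_mult)
  also have "\<dots> = (\<Sum>b<L. \<iota> (G $$ (a, b)) * \<beta> ^ ((q * j mod L) * b))"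
    by (simp add: power_mult power_mod_eq[OF beta_L])
  also have "\<dots> = of_nat L * U $$ (a, q * j mod L)"
    using L_pos by (simp add: e)
  finally show ?thesis using of_nat_L_nonzero by simp
qed

lemma frobenius_power_U:
  assumes "a < J"
  shows "U $$ (a, 1) ^ (q ^ i) = U $$ (a, q ^ i mod L)"
proof (induction i)
  case 0
  then show ?case using L_gt_1 by simp
next
  case (Suc i)
  have "U $$ (a, 1) ^ (q ^ Suc i) = (U $$ (a, 1) ^ (q ^ i)) ^ q"
    by (simp add: mult.commute flip: power_mult)
  also have "\<dots> = U $$ (a, q * (q ^ i mod L) mod L)"
    unfolding Suc.IH using frobenius_U assms L_pos by simp
  finally show ?case by (simp add: mod_mult_right_eq)
qed

lemma q_powers_cong:
  assumes "s < ord L q" and "t < ord L q" and "[q ^ s = q ^ t] (mod L)"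
  shows "s = t"
  using assms order_divides_expdiff[of L q s t] coprime_q_L
  by (auto simp: cong_def coprime_commute)

text \<open>The J powers of q are distinct modulo L and coprime to L, so they exhaust the coprime
  residues. Hence the u_j form a single Frobenius orbit.\<close>

lemma J_eq_q_powers:
  assumes "J = ord L q"
  shows "\<J> = (\<lambda>i. q ^ i mod L) ` {..<J}"
proof (rule card_seteq[symmetric])
  have cop: "q ^ i mod L \<in> \<J>" for i
  proof -
    have c: "coprime (q ^ i mod L) L" using coprime_q_L L_pos by simp
    then have "q ^ i mod L \<noteq> 0" using L_gt_1 by (intro notI) simp
    moreover have "q ^ i mod L < L" using L_pos by simp
    ultimately show ?thesis using c by (auto simp: coprimes_def)
  qed
  then show "(\<lambda>i. q ^ i mod L) ` {..<J} \<subseteq> \<J>" by blast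
  have "inj_on (\<lambda>i. q ^ i mod L) {..<J}"
    using q_powers_cong assms by (intro inj_onI) (auto simp: cong_def)
  then show "card \<J> \<le> card ((\<lambda>i. q ^ i mod L) ` {..<J})"
    using J_eq by (simp add: card_image)
qed simp

text \<open>A relation over the prime field between the entries of u_1, raised to the powers q^i,
  holds for all u_j, so its coefficients vanish. Spanning follows by counting, as the field has q^J
  elements.\<close>

lemma basis_over_col_U:
  assumes "J = m" and "m = ord L q"
  shows "basis_over \<iota> J (col U 1)"
proof -
  let ?f = "\<lambda>c. col U 1 \<bullet> map_vec \<iota> c"
  have f: "?f c = (\<Sum>a<J. \<iota> (c $ a) * U $$ (a, 1))" if "c \<in> carrier_vec J" for c
    unfolding scalar_prod_map_vec[OF that]
    using L_gt_1 carrier_matD[OF U_carrier] by (intro sum.cong) auto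
  have "inj_on ?f (carrier_vec J)"
  proof (rule inj_onI)
    fix c d assume cd: "c \<in> carrier_vec J" "d \<in> carrier_vec J" "?f c = ?f d"
    let ?x = "\<lambda>a. \<iota> (c $ a - d $ a)"
    have 0: "(\<Sum>a<J. ?x a * U $$ (a, 1)) = 0"
      using cd by (simp add: f hom_distribs left_diff_distrib sum_subtractf del: One_nat_def)
    have fr: "x ^ (q ^ i) = x" if "x ^ q = x" for x :: 'k and i
      by (induction i) (simp_all add: power_mult that)
    have "(\<Sum>a<J. ?x a * U $$ (a, j)) = 0" if j: "j \<in> \<J>" for j
    proof -
      obtain i where i: "j = q ^ i mod L"
        using j J_eq_q_powers assms by blast
      have "(\<Sum>a<J. ?x a * U $$ (a, j)) = (\<Sum>a<J. (?x a * U $$ (a, 1)) ^ (q ^ i))"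
        using i by (intro sum.cong refl)
          (simp only: power_mult_distrib frobenius_power_U fr[OF frobenius_range] lessThan_iff)
      also have "\<dots> = (\<Sum>a<J. ?x a * U $$ (a, 1)) ^ (q ^ i)"
        by (rule freshmans_dream_sum'[symmetric]) (simp_all add: CHAR_k prime_q)
      also have "\<dots> = 0" using 0 prime_gt_0_nat[OF prime_q] by simp
      finally show ?thesis .
    qed
    then have "?x a = 0" if "a < J" for a using that by (rule U_rows_independent[of ?x])
    then show "c = d" using cd by (intro eq_vecI) (auto simp: hom_0_iff)
  qed
  moreover have "card (UNIV :: 'k set) = card (UNIV :: 'f set) ^ J"
    using assms card_k card_f by simp
  moreover have "col U 1 \<in> carrier_vec J" using carrier_matD[OF U_carrier] by (metis col_carrier_vec col_dim)
  ultimately show ?thesis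
    unfolding basis_over_iff[OF hom] by (simp add: bij_betw_carrier_vec_UNIV)
qed

text \<open>A relation between the beta^(l_i) puts u_1 into the kernel of the same combination of
  the matrices G C_L^(l_i) H. That combination is invertible by the MRD condition, while u_1 is not
  zero.\<close>

lemma lin_indep_over_exponents:
  assumes "mrd_exponents L J n l G H"
  shows "lin_indep_over \<iota> n (\<lambda>i. \<beta> ^ l i)"
  unfolding lin_indep_over_iff[OF hom]
proof (intro allI impI, rule ccontr)
  fix x i assume s: "(\<Sum>i<n. \<iota> (x i) * \<beta> ^ l i) = 0" and i: "i < n" "x i \<noteq> 0"
  define S where "S = sum_mat J J (\<lambda>i. (vec n x $ i) \<cdot>\<^sub>m (G * cyclic_mat L ^\<^sub>m (l i) * H)) {..<n}"
  have S: "S \<in> carrier_mat J J" by (simp add: S_def sum_mat_def)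
  have "vec n x \<noteq> 0\<^sub>v n" using i by (metis index_vec index_zero_vec(1))
  then have "vec_space.rank J S = J" using assms by (simp add: mrd_exponents_def S_def)
  then have "det S \<noteq> 0" using vec_space.det_rank_iff[OF S] by simp
  then obtain R where R: "R \<in> carrier_mat J J" "R * S = 1\<^sub>m J"
    using det_nonzero_obtain_inverse[OF S] by metis
  have X: "dim_row (G * cyclic_mat L ^\<^sub>m t * H) = J" "dim_col (G * cyclic_mat L ^\<^sub>m t * H) = J" for t
    using carrier_matD[OF G_carrier] carrier_matD[OF H_carrier] by auto
  have z: "(\<Sum>b<J. \<iota> (S $$ (a, b)) * U $$ (b, 1)) = 0" if a: "a < J" for a
  proof -
    have "(\<Sum>b<J. \<iota> (S $$ (a, b)) * U $$ (b, 1))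
        = (\<Sum>b<J. \<Sum>i<n. \<iota> (x i) * (\<iota> ((G * cyclic_mat L ^\<^sub>m (l i) * H) $$ (a, b)) * U $$ (b, 1)))"
      using a X by (intro sum.cong refl)
        (simp add: S_def sum_mat_def hom_sum hom_mult sum_distrib_right mult.assoc)
    also have "\<dots> = (\<Sum>i<n. \<iota> (x i) * (\<Sum>b<J. \<iota> ((G * cyclic_mat L ^\<^sub>m (l i) * H) $$ (a, b)) * U $$ (b, 1)))"
      by (subst sum.swap) (simp add: sum_distrib_left)
    also have "\<dots> = (\<Sum>i<n. \<iota> (x i) * \<beta> ^ l i) * U $$ (a, 1)"
      unfolding shift_GH_mult_U[OF a one_in_J] by (simp add: sum_distrib_right mult.assoc)
    finally show ?thesis using s by simp
  qed
  have "U $$ (c, 1) = 0" if c: "c < J" for c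
  proof -
    have "U $$ (c, 1) = (\<Sum>b<J. \<iota> (if c = b then 1 else 0) * U $$ (b, 1))"
      using c by (simp add: if_distrib[of \<iota>] if_distrib[of "\<lambda>x. x * _"] cong: if_cong)
    also have "\<dots> = (\<Sum>b<J. \<iota> ((R * S) $$ (c, b)) * U $$ (b, 1))"
      using c unfolding R(2) by (intro sum.cong) auto
    also have "\<dots> = (\<Sum>b<J. \<Sum>a<J. \<iota> (R $$ (c, a)) * (\<iota> (S $$ (a, b)) * U $$ (b, 1)))"
      using c carrier_matD[OF R(1)] carrier_matD[OF S]
      by (intro sum.cong refl)
        (simp add: scalar_prod_def lessThan_atLeast0 hom_sum hom_mult sum_distrib_right mult.assoc)
    also have "\<dots> = (\<Sum>a<J. \<iota> (R $$ (c, a)) * (\<Sum>b<J. \<iota> (S $$ (a, b)) * U $$ (b, 1)))"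
      by (subst sum.swap) (simp add: sum_distrib_left)
    also have "\<dots> = 0" using z by simp
    finally show ?thesis .
  qed
  then show False using biorthogonal_cols[OF one_in_J one_in_J] by simp
qed

text \<open>Since u_1 is a basis, messages w_s correspond bijectively to field elements u_1^T w_s,
  which become the coefficients of the linearized polynomial evaluated at the beta^(l_i).\<close>

lemma cs_code_eq_gabidulin_code:
  assumes B: "basis_over \<iota> J (col U 1)"
  shows "cs_code q L J k n l G H = gabidulin_code \<iota> q k n (col U 1) (\<lambda>i. \<beta> ^ l i)"
proof -
  let ?M = "\<lambda>w. mat J n (\<lambda>(b, i). \<Sum>s<k. \<Sum>a<J. w s $ a * (G * cyclic_mat L ^\<^sub>m (q ^ s * l i) * H) $$ (a, b))"
  let ?y = "\<lambda>w s. col U 1 \<bullet> map_vec \<iota> (w s)"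
  have u1: "col U 1 $ a = U $$ (a, 1)" if "a < J" for a
    using that L_gt_1 carrier_matD[OF U_carrier] by simp
  have row: "col U 1 \<^sub>v* map_mat \<iota> (?M w) = vec n (\<lambda>i. \<Sum>s<k. vec k (?y w) $ s * (\<beta> ^ l i) ^ (q ^ s))"
    if w: "\<And>s. s < k \<Longrightarrow> w s \<in> carrier_vec J" for w
  proof (rule eq_vecI)
    fix i assume "i < dim_vec (vec n (\<lambda>i. \<Sum>s<k. vec k (?y w) $ s * (\<beta> ^ l i) ^ (q ^ s)))"
    then have i: "i < n" by simp
    have M: "?M w \<in> carrier_mat J n" by simp
    then have c: "col (?M w) i \<in> carrier_vec J" using i by (intro col_carrier_vec) auto
    have "(col U 1 \<^sub>v* map_mat \<iota> (?M w)) $ i = (\<Sum>b<J. U $$ (b, 1) * \<iota> (?M w $$ (b, i)))"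
      unfolding index_mult_vec_map_mat[OF M i] scalar_prod_map_vec[OF c]
      using i by (intro sum.cong refl) (simp add: u1 mult.commute del: One_nat_def)
    also have "\<dots> = (\<Sum>s<k. (\<Sum>a<J. \<iota> (w s $ a) * U $$ (a, 1)) * \<beta> ^ (1 * (q ^ s * l i)))"
      using w i one_in_J by (rule cs_code_row)
    also have "\<dots> = (\<Sum>s<k. vec k (?y w) $ s * (\<beta> ^ l i) ^ (q ^ s))"
      by (intro sum.cong refl)
        (simp add: scalar_prod_map_vec[OF w] u1 mult.commute[of "q ^ _"] del: One_nat_def flip: power_mult)
    finally show "(col U 1 \<^sub>v* map_mat \<iota> (?M w)) $ i
        = vec n (\<lambda>i. \<Sum>s<k. vec k (?y w) $ s * (\<beta> ^ l i) ^ (q ^ s)) $ i"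
      using i by simp
  qed (simp add: mult_vec_mat_def)
  show ?thesis
    unfolding cs_code_eq[OF G_carrier H_carrier L_pos] gabidulin_code_eq[OF hom B]
  proof (intro equalityI subsetI)
    fix X assume "X \<in> {?M w | w. \<forall>s<k. w s \<in> carrier_vec J}"
    then obtain w where w: "\<And>s. s < k \<Longrightarrow> w s \<in> carrier_vec J" "X = ?M w" by blast
    have y: "vec k (?y w) \<in> carrier_vec k" by simp
    have "col U 1 \<^sub>v* map_mat \<iota> X = vec n (\<lambda>i. \<Sum>s<k. vec k (?y w) $ s * (\<beta> ^ l i) ^ (q ^ s))"
      unfolding w(2) using w(1) by (rule row)
    then have "col U 1 \<^sub>v* map_mat \<iota> X \<in> gabidulin_linear_code q k n (\<lambda>i. \<beta> ^ l i)"
      unfolding gabidulin_linear_code_eq using y by blast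
    then show "X \<in> {M \<in> carrier_mat J n. col U 1 \<^sub>v* map_mat \<iota> M \<in> gabidulin_linear_code q k n (\<lambda>i. \<beta> ^ l i)}"
      using w(2) by simp
  next
    fix X assume "X \<in> {M \<in> carrier_mat J n. col U 1 \<^sub>v* map_mat \<iota> M \<in> gabidulin_linear_code q k n (\<lambda>i. \<beta> ^ l i)}"
    then obtain u where X: "X \<in> carrier_mat J n" and u: "u \<in> carrier_vec k"
      "col U 1 \<^sub>v* map_mat \<iota> X = vec n (\<lambda>i. \<Sum>s<k. u $ s * (\<beta> ^ l i) ^ (q ^ s))"
      unfolding gabidulin_linear_code_eq by blast
    \<comment> \<open>The columns of W are the messages whose field elements are the given
      coefficients.\<close>
    obtain W where W: "W \<in> carrier_mat J k" "col U 1 \<^sub>v* map_mat \<iota> W = u"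
      using basis_over_mat_exists[OF hom B u(1)] .
    have w: "col W s \<in> carrier_vec J" for s using W(1) by (metis carrier_matD(1) col_dim)
    have "vec k (?y (col W)) = u"
      unfolding W(2)[symmetric] using W(1)
      by (intro eq_vecI) (auto simp: index_mult_vec_map_mat mult_vec_mat_def)
    then have "col U 1 \<^sub>v* map_mat \<iota> (?M (col W)) = col U 1 \<^sub>v* map_mat \<iota> X"
      using row[of "col W"] w u(2) by simp
    then have "?M (col W) = X"
      by (intro basis_over_mat_unique[OF hom B _ X]) auto
    then show "X \<in> {?M w | w. \<forall>s<k. w s \<in> carrier_vec J}" using w by blast
  qed
qed

subsection \<open>The left idealizer\<close>

text \<open>
  The entry of \<open>X\<close> with respect to the basis of the \<open>u\<^sub>j\<close>; \<open>L u'\<^sub>j\<close> is the dual basis.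
\<close>

definition idealizer_coord :: "'f mat \<Rightarrow> nat \<Rightarrow> nat \<Rightarrow> 'k" where
  "idealizer_coord X j j' = (\<Sum>b<J. \<Sum>d<J. U $$ (b, j) * \<iota> (X $$ (b, d)) * (of_nat L * U' $$ (d, j')))"

text \<open>On the right, X is applied to the vector whose pairing with each u_(j') is z j'; it is
  assembled from the dual vectors L u'_(j').\<close>

lemma idealizer_coord_expand:
  "(\<Sum>j'\<in>\<J>. idealizer_coord X j j' * z j') =
    (\<Sum>b<J. \<Sum>d<J. U $$ (b, j) * \<iota> (X $$ (b, d)) * (of_nat L * (\<Sum>j'\<in>\<J>. U' $$ (d, j') * z j')))"
proof -
  have "(\<Sum>j'\<in>\<J>. idealizer_coord X j j' * z j') =
    (\<Sum>j'\<in>\<J>. \<Sum>b<J. \<Sum>d<J. U $$ (b, j) * \<iota> (X $$ (b, d)) * (of_nat L * (U' $$ (d, j') * z j')))"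
    by (simp add: idealizer_coord_def sum_distrib_right mult.assoc)
  also have "\<dots> = (\<Sum>b<J. \<Sum>j'\<in>\<J>. \<Sum>d<J. U $$ (b, j) * \<iota> (X $$ (b, d)) * (of_nat L * (U' $$ (d, j') * z j')))"
    by (rule sum.swap)
  also have "\<dots> = (\<Sum>b<J. \<Sum>d<J. \<Sum>j'\<in>\<J>. U $$ (b, j) * \<iota> (X $$ (b, d)) * (of_nat L * (U' $$ (d, j') * z j')))"
    by (intro sum.cong refl sum.swap)
  finally show ?thesis by (simp add: sum_distrib_left)
qed

text \<open>By completeness, u_j^T X is expanded in the rows u_(j')^T. If the off-diagonal
  coordinates vanish, u_j is an eigenvector of the transpose of X.\<close>

lemma idealizer_coord_row:
  assumes "d < J"
  shows "(\<Sum>j'\<in>\<J>. idealizer_coord X j j' * U $$ (d, j')) = (\<Sum>b<J. U $$ (b, j) * \<iota> (X $$ (b, d)))"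
proof -
  have "(\<Sum>j'\<in>\<J>. idealizer_coord X j j' * U $$ (d, j'))
      = (\<Sum>b<J. \<Sum>e<J. if e = d then U $$ (b, j) * \<iota> (X $$ (b, e)) else 0)"
    unfolding idealizer_coord_expand
    using assms biorthogonal_rows[OF assms]
    by (intro sum.cong refl) (simp add: mult.commute[of "U' $$ _"])
  then show ?thesis using assms by simp
qed

lemma coprime_exponent_inj:
  assumes "coprime a L" and "s < ord L q" and "t < ord L q"
    and "\<beta> ^ (a * q ^ s) = \<beta> ^ (a * q ^ t)"
  shows "s = t"
proof -
  have "[a * q ^ s = a * q ^ t] (mod L)" using assms(4) by (simp add: beta_eq_iff)
  then have "[q ^ s = q ^ t] (mod L)" using assms(1) by (simp add: cong_mult_lcancel_nat)
  then show ?thesis by (rule q_powers_cong[OF assms(2,3)])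
qed

text \<open>Take the codeword M of a single unit message in position s. The component of X M along
  u_j is a combination over j' of the rows (beta^(j' q^s l_i))_i. As X M is again a codeword, it is
  also a combination of the rows (beta^(j q^t l_i))_i with t < k, and pairing with the coefficients
  of p kills these.\<close>

lemma idealizer_coord_annihilates:
  assumes X: "X \<in> carrier_mat J J" "\<And>M. M \<in> cs_code q L J k n l G H \<Longrightarrow> X * M \<in> cs_code q L J k n l G H"
    and l: "\<And>i. i < n \<Longrightarrow> l i = (c' * i + c) mod L"
    and j: "j \<in> \<J>" and j': "j' \<in> \<J>" and s: "s < k" and "degree p < n"
    and p: "\<And>t. t < k \<Longrightarrow> poly p (\<beta> ^ (j * c' * q ^ t)) = 0"
  shows "idealizer_coord X j j' * poly p (\<beta> ^ (j' * c' * q ^ s)) = 0"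
proof -
  have pow_l: "\<beta> ^ (e * l i) = \<beta> ^ (e * c) * (\<beta> ^ (e * c')) ^ i" if "i < n" for e i
  proof -
    have "\<beta> ^ (e * l i) = (\<beta> ^ l i) ^ e" by (simp add: mult.commute flip: power_mult)
    also have "\<beta> ^ l i = \<beta> ^ (c' * i + c)" using l[OF that] by (simp add: power_mod_eq[OF beta_L])
    also have "(\<beta> ^ (c' * i + c)) ^ e = \<beta> ^ (e * c) * (\<beta> ^ (e * c')) ^ i"
      by (simp add: algebra_simps flip: power_mult power_add)
    finally show ?thesis .
  qed
  have poly_p: "(\<Sum>i<n. Polynomial.coeff p i * x ^ i) = poly p x" for x
  proof -
    have "(\<Sum>i<n. Polynomial.coeff p i * x ^ i) = (\<Sum>i\<le>degree p. Polynomial.coeff p i * x ^ i)"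
      using \<open>degree p < n\<close> by (intro sum.mono_neutral_right) (auto simp: coeff_eq_0)
    then show ?thesis by (simp add: poly_altdef)
  qed
  \<comment> \<open>For exponents in arithmetic progression the row is geometric up to a scalar, so
    pairing it with the coefficients of p evaluates p at the node.\<close>
  have sum_l: "(\<Sum>i<n. Polynomial.coeff p i * \<beta> ^ (e * l i)) = \<beta> ^ (e * c) * poly p (\<beta> ^ (e * c'))" for e
    unfolding poly_p[symmetric] sum_distrib_left
    by (intro sum.cong refl) (simp add: pow_l mult_ac)
  have main: "(\<Sum>j'\<in>\<J>. idealizer_coord X j j' * (U $$ (a, j')
      * (\<beta> ^ (j' * q ^ s * c) * poly p (\<beta> ^ (j' * q ^ s * c'))))) = 0" if a: "a < J" for a
  proof -
    \<comment> \<open>The codeword of the message that is \<open>unit_vec J a\<close> in position s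
      and zero elsewhere.\<close>
    let ?M = "mat J n (\<lambda>(b, i). (G * cyclic_mat L ^\<^sub>m (q ^ s * l i) * H) $$ (a, b))"
    have "?M = mat J n (\<lambda>(b, i). \<Sum>s'<k. \<Sum>a'<J. (if s' = s then unit_vec J a else 0\<^sub>v J) $ a'
        * (G * cyclic_mat L ^\<^sub>m (q ^ s' * l i) * H) $$ (a', b))"
    proof (intro eq_matI; simp)
      fix b i assume "b < J" "i < n"
      have "(\<Sum>s'<k. \<Sum>a'<J. (if s' = s then unit_vec J a else 0\<^sub>v J) $ a'
          * (G * cyclic_mat L ^\<^sub>m (q ^ s' * l i) * H) $$ (a', b))
        = (\<Sum>s'<k. \<Sum>a'<J. if a' = a then if s' = s
          then (G * cyclic_mat L ^\<^sub>m (q ^ s' * l i) * H) $$ (a', b) else 0 else 0)"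
        using a by (intro sum.cong refl) auto
      also have "\<dots> = (G * cyclic_mat L ^\<^sub>m (q ^ s * l i) * H) $$ (a, b)"
        using a s by simp
      finally show "(G * cyclic_mat L ^\<^sub>m (q ^ s * l i) * H) $$ (a, b)
        = (\<Sum>s'<k. \<Sum>a'<J. (if s' = s then unit_vec J a else 0\<^sub>v J) $ a'
          * (G * cyclic_mat L ^\<^sub>m (q ^ s' * l i) * H) $$ (a', b))" ..
    qed
    moreover have "\<forall>s'<k. (if s' = s then unit_vec J a else 0\<^sub>v J :: 'f vec) \<in> carrier_vec J" by simp
    ultimately have "?M \<in> cs_code q L J k n l G H"
      unfolding cs_code_eq[OF G_carrier H_carrier L_pos] mem_Collect_eq
      by (intro exI[of _ "\<lambda>s'. if s' = s then unit_vec J a else 0\<^sub>v J"] conjI)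
    then have "X * ?M \<in> cs_code q L J k n l G H" by (rule X(2))
    then obtain w where w: "\<And>s'. s' < k \<Longrightarrow> w s' \<in> carrier_vec J"
      and XM: "X * ?M = mat J n (\<lambda>(b, i). \<Sum>s'<k. \<Sum>a<J. w s' $ a * (G * cyclic_mat L ^\<^sub>m (q ^ s' * l i) * H) $$ (a, b))"
      unfolding cs_code_eq[OF G_carrier H_carrier L_pos] by blast
    have lhs: "(\<Sum>b<J. U $$ (b, j) * \<iota> ((X * ?M) $$ (b, i)))
        = (\<Sum>j'\<in>\<J>. idealizer_coord X j j' * (\<beta> ^ (j' * q ^ s * l i) * U $$ (a, j')))" if i: "i < n" for i
    proof -
      have "(\<Sum>b<J. U $$ (b, j) * \<iota> ((X * ?M) $$ (b, i)))
        = (\<Sum>b<J. \<Sum>d<J. U $$ (b, j) * \<iota> (X $$ (b, d)) * \<iota> (?M $$ (d, i)))"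
        using X(1) i by (intro sum.cong refl)
          (simp add: scalar_prod_def lessThan_atLeast0 hom_sum hom_mult sum_distrib_left mult.assoc)
      also have "\<dots> = (\<Sum>b<J. \<Sum>d<J. U $$ (b, j) * \<iota> (X $$ (b, d))
          * (of_nat L * (\<Sum>j'\<in>\<J>. U' $$ (d, j') * (\<beta> ^ (j' * q ^ s * l i) * U $$ (a, j')))))"
        using i a by (intro sum.cong refl) (simp add: index_shift_GH mult_ac)
      finally show ?thesis unfolding idealizer_coord_expand .
    qed
    have rhs: "(\<Sum>b<J. U $$ (b, j) * \<iota> ((X * ?M) $$ (b, i)))
        = (\<Sum>t<k. (\<Sum>a<J. \<iota> (w t $ a) * U $$ (a, j)) * \<beta> ^ (j * q ^ t * l i))" if i: "i < n" for i
      unfolding XM mult.assoc by (rule cs_code_row[OF w i j])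
    have "(\<Sum>j'\<in>\<J>. idealizer_coord X j j' * (U $$ (a, j')
        * (\<beta> ^ (j' * q ^ s * c) * poly p (\<beta> ^ (j' * q ^ s * c')))))
      = (\<Sum>i<n. Polynomial.coeff p i * (\<Sum>j'\<in>\<J>. idealizer_coord X j j' * (\<beta> ^ (j' * q ^ s * l i) * U $$ (a, j'))))"
      unfolding sum_l[symmetric] sum_distrib_left by (subst sum.swap) (simp add: mult_ac)
    also have "\<dots> = (\<Sum>i<n. Polynomial.coeff p i * (\<Sum>t<k. (\<Sum>a<J. \<iota> (w t $ a) * U $$ (a, j)) * \<beta> ^ (j * q ^ t * l i)))"
      using lhs rhs by (intro sum.cong refl) simp
    also have "\<dots> = (\<Sum>t<k. (\<Sum>a<J. \<iota> (w t $ a) * U $$ (a, j)) * (\<Sum>i<n. Polynomial.coeff p i * \<beta> ^ (j * q ^ t * l i)))"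
      unfolding sum_distrib_left by (subst sum.swap) (simp add: mult_ac)
    also have "\<dots> = 0"
      unfolding sum_l using p by (intro sum.neutral) (simp add: mult_ac)
    finally show ?thesis .
  qed
  let ?g = "\<lambda>i. idealizer_coord X j i * (\<beta> ^ (i * q ^ s * c) * poly p (\<beta> ^ (i * q ^ s * c')))"
  \<comment> \<open>\<open>main\<close> holds for every a; pairing over a with the dual vector L
    u'_(j') isolates the summand j'.\<close>
  have "0 = (\<Sum>a<J. of_nat L * U' $$ (a, j') * (\<Sum>i\<in>\<J>. idealizer_coord X j i * (U $$ (a, i)
      * (\<beta> ^ (i * q ^ s * c) * poly p (\<beta> ^ (i * q ^ s * c'))))))"
    using main by simp
  also have "\<dots> = (\<Sum>i\<in>\<J>. ?g i * (of_nat L * (\<Sum>a<J. U' $$ (a, j') * U $$ (a, i))))"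
    unfolding sum_distrib_left by (subst sum.swap) (simp add: mult_ac)
  also have "\<dots> = (\<Sum>i\<in>\<J>. if j' = i then ?g i else 0)"
    by (intro sum.cong refl) (simp add: biorthogonal_cols[OF j'])
  also have "\<dots> = ?g j'" using j' by simp
  finally show ?thesis by (simp add: mult_ac)
qed

lemma idealizer_coord_offdiag:
  assumes X: "X \<in> carrier_mat J J" "\<And>M. M \<in> cs_code q L J k n l G H \<Longrightarrow> X * M \<in> cs_code q L J k n l G H"
    and l: "\<And>i. i < n \<Longrightarrow> l i = (c' * i + c) mod L"
    and k: "k < n" "k \<le> ord L q"
    and cop: "coprime (\<Sum>t<k. c' * q ^ t) L" "coprime c' L"
    and j: "j \<in> \<J>" and j': "j' \<in> \<J>" and "j \<noteq> j'"
  shows "idealizer_coord X j j' = 0"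
proof (rule ccontr)
  assume nz: "idealizer_coord X j j' \<noteq> 0"
  let ?x = "\<lambda>j t. \<beta> ^ (j * c' * q ^ t)"
  \<comment> \<open>The polynomial with the nodes of j as roots. Its degree is at most k, hence
    below n. If the coordinate is nonzero, p must vanish at the nodes of j' as well.\<close>
  define p where "p = (\<Prod>t<k. [:- ?x j t, 1:])"
  have poly_p: "poly p x = (\<Prod>t<k. x - ?x j t)" for x by (simp add: p_def poly_prod)
  have "degree p \<le> k"
    using degree_prod_sum_le[of "{..<k}" "\<lambda>t. [:- ?x j t, 1:]"] by (simp add: p_def comp_def)
  then have deg: "degree p < n" using k by simp
  have "poly p (?x j' s) = 0" if "s < k" for s
    using idealizer_coord_annihilates[OF X l j j' that deg] nz by (auto simp: poly_p)
  then have sub: "?x j' ` {..<k} \<subseteq> ?x j ` {..<k}" by (auto simp: poly_p)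
  have inj: "inj_on (?x i) {..<k}" if "i \<in> \<J>" for i
  proof (rule inj_onI)
    fix s t assume "s \<in> {..<k}" "t \<in> {..<k}" "?x i s = ?x i t"
    then show "s = t"
      using coprime_exponent_inj[of "i * c'" s t] k cop that by (auto simp: coprimes_def)
  qed
  \<comment> \<open>Both sets have k elements because k is at most the order of q, so the inclusion
    is an equality.\<close>
  have "?x j' ` {..<k} = ?x j ` {..<k}"
    using sub inj[OF j] inj[OF j'] by (intro card_subset_eq) (auto simp: card_image)
  \<comment> \<open>The product of the nodes of i is beta to the power i times the sum of the c'
    q^t. As this sum is coprime to L, the product determines i.\<close>
  moreover have "\<Prod>(?x i ` {..<k}) = \<beta> ^ (i * (\<Sum>t<k. c' * q ^ t))" if "i \<in> \<J>" for i
  proof -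
    have "\<Prod>(?x i ` {..<k}) = (\<Prod>t<k. ?x i t)"
      using prod.reindex[OF inj[OF that], of "\<lambda>x. x"] by simp
    also have "\<dots> = \<beta> ^ (\<Sum>t<k. i * c' * q ^ t)" by (rule power_sum[symmetric])
    finally show ?thesis by (simp add: sum_distrib_left mult.assoc)
  qed
  ultimately have "\<beta> ^ (j' * (\<Sum>t<k. c' * q ^ t)) = \<beta> ^ (j * (\<Sum>t<k. c' * q ^ t))"
    using j j' by metis
  then have "[j' = j] (mod L)"
    unfolding beta_eq_iff using cop(1) by (simp add: cong_mult_rcancel_nat)
  then show False
    using coprimes_less[OF j] coprimes_less[OF j'] \<open>j \<noteq> j'\<close> by (simp add: cong_def)
qed

text \<open>The u_j with j coprime to L form a basis of eigenvectors of the transpose, with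
  eigenvalues in a field where x^(q^m) = x. The resulting matrix equation descends along the
  injective \<iota> and can then be mapped into any other extension.\<close>

lemma idealizer_pow:
  assumes X: "X \<in> carrier_mat J J"
    and diag: "\<And>j j'. j \<in> \<J> \<Longrightarrow> j' \<in> \<J> \<Longrightarrow> j \<noteq> j' \<Longrightarrow> idealizer_coord X j j' = 0"
  shows "transpose_mat X ^\<^sub>m (q ^ m) = transpose_mat X"
proof -
  let ?Y = "transpose_mat X"
  have Y: "?Y \<in> carrier_mat J J" using X by simp
  have mY: "map_mat \<iota> ?Y \<in> carrier_mat J J" using Y by simp
  have cU: "col U j \<in> carrier_vec J" for j using carrier_matD[OF U_carrier] by (metis col_dim)
  have eig: "map_mat \<iota> ?Y *\<^sub>v col U j = idealizer_coord X j j \<cdot>\<^sub>v col U j" if j: "j \<in> \<J>" for j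
  proof (rule eq_vecI)
    fix d assume "d < dim_vec (idealizer_coord X j j \<cdot>\<^sub>v col U j)"
    then have d: "d < J" using carrier_matD[OF U_carrier] by simp
    have "(map_mat \<iota> ?Y *\<^sub>v col U j) $ d = (\<Sum>b<J. U $$ (b, j) * \<iota> (X $$ (b, d)))"
      unfolding index_mult_mat_vec_sum[OF mY cU d]
      using d X carrier_matD[OF U_carrier] coprimes_less[OF j]
      by (intro sum.cong refl) (simp add: mult.commute)
    also have "\<dots> = (\<Sum>i\<in>\<J>. if j = i then idealizer_coord X j i * U $$ (d, i) else 0)"
      unfolding idealizer_coord_row[OF d, symmetric] using diag[OF j] by (intro sum.cong) auto
    finally show "(map_mat \<iota> ?Y *\<^sub>v col U j) $ d = (idealizer_coord X j j \<cdot>\<^sub>v col U j) $ d"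
      using j d carrier_matD[OF U_carrier] coprimes_less[OF j] by simp
  qed (use X carrier_matD[OF U_carrier] in simp)
  have mYp: "map_mat \<iota> (?Y ^\<^sub>m (q ^ m)) = map_mat \<iota> ?Y ^\<^sub>m (q ^ m)"
    using Y by (rule mat_hom_pow)
  have Yp: "?Y ^\<^sub>m (q ^ m) \<in> carrier_mat J J" using Y by simp
  have "idealizer_coord X j j ^ (q ^ m) = idealizer_coord X j j" for j
    using finite_field_power_card_eq_same[of "idealizer_coord X j j"] card_k by simp
  then have same: "map_mat \<iota> (?Y ^\<^sub>m (q ^ m)) *\<^sub>v col U j = map_mat \<iota> ?Y *\<^sub>v col U j" if "j \<in> \<J>" for j
    unfolding mYp pow_mat_eigenvector[OF mY cU eig[OF that]] using eig[OF that] by simp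
  show ?thesis
  proof (rule eq_matI)
    fix d b assume "d < dim_row ?Y" "b < dim_col ?Y"
    then have db: "d < J" "b < J" using X by auto
    let ?x = "\<lambda>b. \<iota> ((?Y ^\<^sub>m (q ^ m)) $$ (d, b) - ?Y $$ (d, b))"
    have "(\<Sum>b<J. ?x b * U $$ (b, j)) = 0" if j: "j \<in> \<J>" for j
    proof -
      have e: "(\<Sum>b<J. \<iota> (Z $$ (d, b)) * U $$ (b, j)) = (map_mat \<iota> Z *\<^sub>v col U j) $ d"
        if Z: "Z \<in> carrier_mat J J" for Z
      proof -
        have "map_mat \<iota> Z \<in> carrier_mat J J" using Z by simp
        from index_mult_mat_vec_sum[OF this cU db(1)] show ?thesis
          using Z db carrier_matD[OF U_carrier] coprimes_less[OF j] by simp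
      qed
      show ?thesis
        unfolding hom_minus left_diff_distrib sum_subtractf e[OF Y] e[OF Yp] same[OF j] by simp
    qed
    then have "?x b = 0" using db(2) by (rule U_rows_independent[of ?x])
    then show "(?Y ^\<^sub>m (q ^ m)) $$ (d, b) = ?Y $$ (d, b)" by simp
  qed (use X carrier_matD[OF Yp] in auto)
qed

section \<open>Separation from Gabidulin codes when J differs from m\<close>

lemma cs_code_not_gabidulin:
  fixes \<iota>' :: "'f \<Rightarrow> 'e :: finite_field" and b :: "nat \<Rightarrow> 'e"
  assumes m: "m = ord L q" "m < J" and k: "1 \<le> k" "k < n" "n \<le> m"
    and l: "\<And>i. i < n \<Longrightarrow> l i = (c' * i + c) mod L"
    and cop: "coprime (\<Sum>t<k. c' * q ^ t) L"
    and hom': "field_hom \<iota>'" and card_e: "card (UNIV :: 'e set) = q ^ J"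
    and B: "basis_over \<iota>' J B"
  shows "cs_code q L J k n l G H \<noteq> gabidulin_code \<iota>' q k n B b"
proof
  assume eq: "cs_code q L J k n l G H = gabidulin_code \<iota>' q k n B b"
  interpret E: field_hom \<iota>' by (rule hom')
  have q: "q > 1" using prime_q by (rule prime_gt_1_nat)
  have "q ^ m < q ^ J" using q m by (simp add: power_strict_increasing)
  moreover have "m > 0" using k by simp
  then have "q ^ m > 1" using q by (rule one_less_power[rotated])
  from card_power_fixpoints[OF this, where ?'e = 'e]
  have "card {x :: 'e. x ^ (q ^ m) = x} \<le> q ^ m" .
  ultimately have "{x :: 'e. x ^ (q ^ m) = x} \<noteq> UNIV" using card_e by auto
  \<comment> \<open>The field has q^J > q^m elements, more than the fixed points of the power
    q^m.\<close>
  then obtain x :: 'e where x: "x ^ (q ^ m) \<noteq> x" by blast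
  obtain X where X: "X \<in> carrier_mat J J" "B \<^sub>v* map_mat \<iota>' X = x \<cdot>\<^sub>v B"
    "\<And>M. M \<in> gabidulin_code \<iota>' q k n B b \<Longrightarrow> X * M \<in> gabidulin_code \<iota>' q k n B b"
    using gabidulin_code_scalar_mat[OF hom' B, where q = q and k = k and n = n and b = b] by metis
  have ideal: "X * M \<in> cs_code q L J k n l G H" if "M \<in> cs_code q L J k n l G H" for M
    using that unfolding eq by (rule X(3))
  \<comment> \<open>c' is a factor of the sum, so it inherits coprimality to L.\<close>
  have "coprime c' L"
    using cop unfolding sum_distrib_left[symmetric] by simp
  then have "idealizer_coord X j j' = 0" if "j \<in> \<J>" "j' \<in> \<J>" "j \<noteq> j'" for j j'
    using idealizer_coord_offdiag[OF X(1) ideal l _ _ cop _ that] k m by simp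
  then have pow: "transpose_mat X ^\<^sub>m (q ^ m) = transpose_mat X"
    by (rule idealizer_pow[OF X(1)])
  let ?Y = "map_mat \<iota>' (transpose_mat X)"
  have Bc: "B \<in> carrier_vec J" using B by (simp add: basis_over_def)
  have Y: "?Y \<in> carrier_mat J J" using X by simp
  \<comment> \<open>B X = x B read as an eigenvector equation, now over the field with q^J
    elements.\<close>
  have eig: "?Y *\<^sub>v B = x \<cdot>\<^sub>v B"
  proof (rule eq_vecI)
    fix i assume "i < dim_vec (x \<cdot>\<^sub>v B)"
    then have i: "i < J" using Bc by simp
    have "(?Y *\<^sub>v B) $ i = (B \<^sub>v* map_mat \<iota>' X) $ i"
      unfolding index_mult_mat_vec_sum[OF Y Bc i]
      using i X(1) Bc by (simp add: mult_vec_mat_def scalar_prod_def lessThan_atLeast0 mult.commute)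
    then show "(?Y *\<^sub>v B) $ i = (x \<cdot>\<^sub>v B) $ i" using X(2) by simp
  qed (use X(1) Bc in simp)
  have "?Y ^\<^sub>m (q ^ m) = ?Y"
    using E.mat_hom_pow[of "transpose_mat X" J "q ^ m"] X(1) pow by simp
  then have "x ^ (q ^ m) \<cdot>\<^sub>v B = x \<cdot>\<^sub>v B"
    using pow_mat_eigenvector[OF Y Bc eig, of "q ^ m"] eig by simp
  moreover obtain i where i: "i < J" "B $ i \<noteq> 0" using basis_over_nonzero[OF hom' B] .
  ultimately have "x ^ (q ^ m) * B $ i = x * B $ i"
    using Bc by (metis carrier_vecD index_smult_vec(1))
  then show False using i x by simp
qed

text \<open>Multiplication by the inverse of \<open>T_f\<close> would make C_1 a Gabidulin code for
  the changed basis B \<open>T_f\<close>, which is already excluded.\<close>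

lemma cs_code_Q2_not_gabidulin:
  fixes \<iota>' :: "'f \<Rightarrow> 'e :: finite_field" and b :: "nat \<Rightarrow> 'e"
  assumes m: "m = ord L q" "m < J" and k: "1 \<le> k" "k < n" "n \<le> m"
    and l: "\<And>i. i < n \<Longrightarrow> l i = (c' * i + c) mod L"
    and cop: "coprime (\<Sum>t<k. c' * q ^ t) L"
    and hom': "field_hom \<iota>'" and card_e: "card (UNIV :: 'e set) = q ^ J"
    and B: "basis_over \<iota>' J B"
  shows "cs_code q L J k n l G Q2 \<noteq> gabidulin_code \<iota>' q k n B b"
proof
  assume eq: "cs_code q L J k n l G Q2 = gabidulin_code \<iota>' q k n B b"
  obtain R where R: "R \<in> carrier_mat J J" "T_f * R = 1\<^sub>m J" "R * T_f = 1\<^sub>m J"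
    by (rule T_f_inverse)
  have C1: "M \<in> carrier_mat J n" if "M \<in> cs_code q L J k n l G H" for M
    using that unfolding cs_code_eq[OF G_carrier H_carrier L_pos] by auto
  have "(*) R ` cs_code q L J k n l G Q2 = (\<lambda>M. R * (T_f * M)) ` cs_code q L J k n l G H"
    unfolding cs_code_Q2 image_image ..
  also have "\<dots> = (\<lambda>M. M) ` cs_code q L J k n l G H"
  proof (rule image_cong)
    fix M assume "M \<in> cs_code q L J k n l G H"
    then have "M \<in> carrier_mat J n" by (rule C1)
    then show "R * (T_f * M) = M"
      using assoc_mult_mat[OF R(1) T_f_carrier, of M n] R(3) by simp
  qed simp
  finally have "cs_code q L J k n l G H = gabidulin_code \<iota>' q k n (B \<^sub>v* map_mat \<iota>' T_f) b"
    unfolding eq using image_gabidulin_code[OF hom' B R(1) T_f_carrier R(3,2)] by simp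
  then show False
    using cs_code_not_gabidulin[OF m k l cop hom' card_e
        basis_over_mult_inverse[OF hom' B R(1) T_f_carrier R(3,2)]] by blast
qed

end

theorem theorem12:
  fixes q L k n m J :: nat
    and \<iota> :: "'f :: finite_field \<Rightarrow> 'k :: finite_field"
    and \<iota>' :: "'f \<Rightarrow> 'e :: finite_field"
    and \<beta> :: 'k
    and U U' T :: "'k mat"
    and G H :: "'f mat"
    and l :: "nat \<Rightarrow> nat"
    and C1 C2 :: "'f mat set"
  assumes "prime q" and "L > 0" and "coprime q L"
    and "m = ord L q" and "J = card (coprimes L)"
    and "1 \<le> k" and "k < n" and "n \<le> m" and "m \<le> J"
    and "card (UNIV :: 'f set) = q" and "card (UNIV :: 'k set) = q ^ m" and "field_hom \<iota>"
    and "primitive_root_of_unity L \<beta>"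
    and "U \<in> carrier_mat J L" and "U' \<in> carrier_mat J L"
    and "vec_space.rank J (select_cols U (coprime_list L)) = J"
    and "transpose_mat (select_cols U' (coprime_list L))
         = inverse (of_nat L) \<cdot>\<^sub>m the (mat_inverse (select_cols U (coprime_list L)))"
    and "(\<forall>j<L. j \<notin> coprimes L \<longrightarrow> col U j = 0\<^sub>v J) \<or>
         (\<forall>j<L. j \<notin> coprimes L \<longrightarrow> col U' j = 0\<^sub>v J)"
    and "elements_mat (U * V_tilde_mat L \<beta>) \<subseteq> range \<iota>"
    and "elements_mat (V_mat L \<beta> * transpose_mat U') \<subseteq> range \<iota>"
    and "G = map_mat (inv_into UNIV \<iota>) (U * V_tilde_mat L \<beta>)"
    and "H = map_mat (inv_into UNIV \<iota>) (V_mat L \<beta> * transpose_mat U')"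
    and "inj_on l {..<n}" and "\<forall>i<n. l i \<le> L - 1"
    and "mrd_exponents L J n l G H"
    and "C1 = cs_code q L J k n l G H"
    and "C2 = cs_code q L J k n l G
                (poly_mat (map_poly (inv_into UNIV \<iota>) (tau L \<beta>)) (cyclic_mat L) * transpose_mat G)"
    and "T = T_mat L \<beta> U"
  shows
    "(\<forall>c c'. J \<noteq> m \<and> c \<le> L - 1 \<and> 1 \<le> c' \<and> c' \<le> L - 1
        \<and> coprime (\<Sum>j=0..k-1. c' * q ^ j) L
        \<and> (\<forall>j<n. l j = (c' * j + c) mod L)
        \<and> card (UNIV :: 'e set) = q ^ J \<and> field_hom \<iota>' \<longrightarrow>
        (\<forall>B b. basis_over \<iota>' J B \<and> lin_indep_over \<iota>' n b \<longrightarrow>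
           C1 \<noteq> gabidulin_code \<iota>' q k n B b \<and> C2 \<noteq> gabidulin_code \<iota>' q k n B b))
     \<and>
     (J = m \<longrightarrow>
        lin_indep_over \<iota> n (\<lambda>i. \<beta> ^ l i)
        \<and> basis_over \<iota> J (col U 1)
        \<and> T \<in> carrier_mat J J \<and> invertible_mat T \<and> elements_mat T \<subseteq> range \<iota>
        \<and> basis_over \<iota> J (col U 1 \<^sub>v* the (mat_inverse T))
        \<and> C1 = gabidulin_code \<iota> q k n (col U 1) (\<lambda>i. \<beta> ^ l i)
        \<and> C2 = (\<lambda>M. map_mat (inv_into UNIV \<iota>) T * M) ` gabidulin_code \<iota> q k n (col U 1) (\<lambda>i. \<beta> ^ l i)
        \<and> C2 = gabidulin_code \<iota> q k n (col U 1 \<^sub>v* the (mat_inverse T)) (\<lambda>i. \<beta> ^ l i))"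
proof -
  have J: "J > 1" using assms(6-9) by simp
  interpret S: circular_shift_setting q L m J \<iota> \<beta> U U' G H
    by (rule circular_shift_setting.intro[OF assms(1,2,3,5) J assms(10-22)])
  interpret field_hom \<iota> by fact
  have C1: "C1 = cs_code q L J k n l G H" by fact
  have C2: "C2 = cs_code q L J k n l G S.Q2" by fact
  \<comment> \<open>Truncated subtraction: for k = 0 the two index sets would differ.\<close>
  have k: "{0..k - 1} = {..<k}" using \<open>1 \<le> k\<close> by auto
  show ?thesis
  proof (intro conjI[of "\<forall>c. _ c"] allI impI; (elim conjE)?)
    fix c c' B and b :: "nat \<Rightarrow> 'e"
    assume "J \<noteq> m" and cop: "coprime (\<Sum>j = 0..k - 1. c' * q ^ j) L"
      and l: "\<forall>j<n. l j = (c' * j + c) mod L"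
      and e: "card (UNIV :: 'e set) = q ^ J" "field_hom \<iota>'" and B: "basis_over \<iota>' J B"
    have m: "m < J" using \<open>J \<noteq> m\<close> \<open>m \<le> J\<close> by simp
    have cop': "coprime (\<Sum>t<k. c' * q ^ t) L" using cop unfolding k .
    have l': "l i = (c' * i + c) mod L" if "i < n" for i using l that by blast
    show "C1 \<noteq> gabidulin_code \<iota>' q k n B b \<and> C2 \<noteq> gabidulin_code \<iota>' q k n B b"
      unfolding C1 C2
      using S.cs_code_not_gabidulin[OF \<open>m = ord L q\<close> m assms(6-8) l' cop' e(2,1) B]
        S.cs_code_Q2_not_gabidulin[OF \<open>m = ord L q\<close> m assms(6-8) l' cop' e(2,1) B]
      by blast
  next
    assume Jm: "J = m"
    have basis: "basis_over \<iota> J (col U 1)"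
      using Jm \<open>m = ord L q\<close> by (rule S.basis_over_col_U)
    have C1_gab: "C1 = gabidulin_code \<iota> q k n (col U 1) (\<lambda>i. \<beta> ^ l i)"
      unfolding C1 using basis by (rule S.cs_code_eq_gabidulin_code)
    obtain R where R: "R \<in> carrier_mat J J" "S.T_f * R = 1\<^sub>m J" "R * S.T_f = 1\<^sub>m J"
      and inv: "mat_inverse T = Some (map_mat \<iota> R)"
      unfolding assms(28) by (rule S.T_f_inverse)
    have T: "T \<in> carrier_mat J J" "T = map_mat \<iota> S.T_f"
      unfolding assms(28) by (simp_all add: S.map_T_f)
    have T_f: "map_mat (inv_into UNIV \<iota>) T = S.T_f"
      unfolding T(2) by (rule eq_matI) (simp_all add: inv_f_f)
    have "invertible_mat T"
      using mat_inverse(2)[OF T(1) inv] T(1)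
      by (auto simp: invertible_mat_def inverts_mat_def square_mat.simps)
    moreover have "elements_mat T \<subseteq> range \<iota>"
      unfolding T(2) by (auto simp: elements_mat_def)
    moreover have "basis_over \<iota> J (col U 1 \<^sub>v* the (mat_inverse T))"
      unfolding inv option.sel
      by (rule basis_over_mult_inverse[OF \<open>field_hom \<iota>\<close> basis S.T_f_carrier R])
    moreover have C2_T: "C2 = (*) S.T_f ` gabidulin_code \<iota> q k n (col U 1) (\<lambda>i. \<beta> ^ l i)"
      unfolding C2 S.cs_code_Q2 C1_gab[unfolded C1] ..
    moreover have "C2 = gabidulin_code \<iota> q k n (col U 1 \<^sub>v* the (mat_inverse T)) (\<lambda>i. \<beta> ^ l i)"
      unfolding C2_T inv option.sel
      by (rule image_gabidulin_code[OF \<open>field_hom \<iota>\<close> basis S.T_f_carrier R])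
    ultimately show "lin_indep_over \<iota> n (\<lambda>i. \<beta> ^ l i)
        \<and> basis_over \<iota> J (col U 1)
        \<and> T \<in> carrier_mat J J \<and> invertible_mat T \<and> elements_mat T \<subseteq> range \<iota>
        \<and> basis_over \<iota> J (col U 1 \<^sub>v* the (mat_inverse T))
        \<and> C1 = gabidulin_code \<iota> q k n (col U 1) (\<lambda>i. \<beta> ^ l i)
        \<and> C2 = (\<lambda>M. map_mat (inv_into UNIV \<iota>) T * M) ` gabidulin_code \<iota> q k n (col U 1) (\<lambda>i. \<beta> ^ l i)
        \<and> C2 = gabidulin_code \<iota> q k n (col U 1 \<^sub>v* the (mat_inverse T)) (\<lambda>i. \<beta> ^ l i)"
      unfolding T_f using S.lin_indep_over_exponents[OF \<open>mrd_exponents L J n l G H\<close>] basis T(1) C1_gab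
      by blast
  qed
qed

end
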